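(* Let $P$ be a pseudo-polygon and assign to every invisible pair of $P$ its designated blocker. Let $(p_i,p_j)$ be an invisible pair, and suppose $p_k$ is the blocker assigned to it, where $p_k\in\partial(p_i,p_j)$ (the case $p_k\in\partial(p_j,p_i)$ being the mirror image, obtained by reversing the orientation of the boundary). Let $p_s$ be any vertex in $\partial(p_i,p_{k-1})$. Then exactly one of the following two cases holds: (1) $\{p_s,p_k\}$ is a visible pair, and the blocker assigned to the invisible pair $(p_s,p_j)$ is $p_k$; or (2) $(p_s,p_k)$ is an invisible pair, and if the blocker assigned to $(p_s,p_k)$ is $p_t$, then $(p_s,p_j)$ is assigned the blocker $p_t$.
   Context: **Pseudo-polygons.** An arrangement of pseudo-lines is a collection of simple curves in $\mathbb{R}^2$, each of which separates the plane, such that each pair of them intersects at exactly one point, where they cross. Let $P=\{p_0,\dots,p_{n-1}\}$ ($n\ge 3$) be a set of points in $\mathbb{R}^2$ and $\mathcal{L}$ an arrangement of $\binom n2$ pseudo-lines such that every pair of points $p_i,p_j$ lies on exactly one pseudo-line of $\mathcal{L}$, denoted $L_{i,j}$, and every pseudo-line in $\mathcal{L}$ contains exactly two points of $P$; $(P,\mathcal{L})$ is a pseudo configuration of points in general position. The subsegment of $L_{i,j}$ connecting $p_i$ and $p_j$ is the segment $p_ip_j$; removing it leaves two rays, one starting at $p_i$ and moving away from $p_j$, the other starting at $p_j$ and moving away from $p_i$. Indices are modulo $n$. Let $e_i$ be the segment $p_ip_{i+1}$. The segments $e_0,\dots,e_{n-1}$ form a pseudo-polygon (with boundary edges $e_i$)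 if $e_i\cap e_{i+1}=\{p_{i+1}\}$ for all $i$ and non-consecutive $e_i,e_j$ are disjoint. Vertices are indexed in counterclockwise order along the boundary. The pseudo-polygon separates the plane into an inside and an outside; two vertices $p_i,p_j$ see each other if the segment $p_ip_j$ does not go outside the pseudo-polygon. **Combinatorial notions.** $\partial(p_i,p_j)$ denotes the vertices and boundary edges encountered when walking counterclockwise along the boundary from $p_i$ to $p_j$ (inclusive). Two vertices that see each other form a visible pair $\{p_i,p_j\}$ (unordered). If distinct $p_i,p_j$ do not see each other, both ordered pairs $(p_i,p_j)$ and $(p_j,p_i)$ are called invisible pairs. **Designated blocker.** Let $(p_i,p_j)$ be an invisible pair. A vertex $p_k\in\partial(p_i,p_j)$ is a designated blocker for $(p_i,p_j)$ if $p_i$ sees $p_k$ and the ray of $L_{i,k}$ starting at $p_k$ and moving away from $p_i$ first exits the pseudo-polygon through a boundary edge in $\partial(p_j,p_i)$. Similarly, $p_k\in\partial(p_j,p_i)$ is a designated blocker for $(p_i,p_j)$ if $p_i$ sees $p_k$ and the ray of $L_{i,k}$ starting at $p_k$ and moving away from $p_i$ first exits the pseudo-polygon through a boundary edge in $\partial(p_i,p_j)$. (Here $k\neq i,j$.) Every invisible pair in a pseudo-polygon has exactly one designated blocker, so the assignment is well defined. Moreover, if $p_k\in\partial(p_i,p_j)$ is the designated blocker of $(p_i,p_j)$, then $p_k$ is a candidate blocker for $(p_i,p_j)$: no vertex of $\partial(p_i,p_{k-1})$ sees a vertex of $\partial(p_{k+1},p_j)$ (so $(p_s,p_j)$ in the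 claim is indeed an invisible pair). *)

theory Defs
  imports "HOL-Complex_Analysis.Complex_Analysis"
begin

section \<open>Pseudo-lines\<close>

text \<open>
  The plane is \<^typ>\<open>complex\<close>, so that the library's winding number is available for orientations.
  A simple curve that can serve as a pseudo-line is an injective continuous image of the real line
  with both ends going to infinity.
\<close>

definition curve_param :: "(real \<Rightarrow> complex) \<Rightarrow> complex set \<Rightarrow> bool" where
  "curve_param \<gamma> L \<longleftrightarrow>
     continuous_on UNIV \<gamma> \<and> inj \<gamma> \<and> range \<gamma> = L \<and>
     filterlim \<gamma> at_infinity at_top \<and> filterlim \<gamma> at_infinity at_bot"

definition pseudo_line :: "complex set \<Rightarrow> bool" where
  "pseudo_line L \<longleftrightarrow> (\<exists>\<gamma>. curve_param \<gamma> L) \<and> \<not> connected (- L)"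

definition crosses_at :: "complex set \<Rightarrow> complex set \<Rightarrow> complex \<Rightarrow> bool" where
  "crosses_at M L x \<longleftrightarrow>
     (\<exists>\<gamma> t \<epsilon> C D. curve_param \<gamma> M \<and> \<gamma> t = x \<and> \<epsilon> > 0 \<and>
        C \<in> components (- L) \<and> D \<in> components (- L) \<and> C \<noteq> D \<and>
        \<gamma> ` {t - \<epsilon><..<t} \<subseteq> C \<and> \<gamma> ` {t<..<t + \<epsilon>} \<subseteq> D)"

definition pseudo_line_arrangement :: "complex set set \<Rightarrow> bool" where
  "pseudo_line_arrangement \<L> \<longleftrightarrow>
     (\<forall>L\<in>\<L>. pseudo_line L) \<and>
     (\<forall>L\<in>\<L>. \<forall>M\<in>\<L>. L \<noteq> M \<longrightarrow> (\<exists>x. L \<inter> M = {x} \<and> crosses_at M L x))"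

text \<open>The set below does not depend on the choice of the parametrisation.\<close>

definition pl_segment :: "complex set \<Rightarrow> complex \<Rightarrow> complex \<Rightarrow> complex set" where
  "pl_segment L a b =
     {z. \<exists>\<gamma> r s t. curve_param \<gamma> L \<and> \<gamma> r = a \<and> \<gamma> t = b \<and> s \<in> closed_segment r t \<and> z = \<gamma> s}"

text \<open>The part of \<open>L\<close> that starts at \<open>b\<close> and moves away from \<open>a\<close>; its starting point is not included.\<close>

definition pl_ray :: "complex set \<Rightarrow> complex \<Rightarrow> complex \<Rightarrow> complex set" where
  "pl_ray L a b = {z \<in> L - pl_segment L a b. b \<in> pl_segment L a z}"


section \<open>Pseudo-polygons\<close>

text \<open>The points are \<open>p 0, \<dots>, p (n - 1)\<close>; vertices and edges are referred to by their indices below \<open>n\<close>.\<close>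

definition pseudo_configuration :: "nat \<Rightarrow> (nat \<Rightarrow> complex) \<Rightarrow> complex set set \<Rightarrow> bool" where
  "pseudo_configuration n p \<L> \<longleftrightarrow>
     n \<ge> 3 \<and> inj_on p {..<n} \<and>
     pseudo_line_arrangement \<L> \<and> card \<L> = n choose 2 \<and>
     (\<forall>i<n. \<forall>j<n. i \<noteq> j \<longrightarrow> (\<exists>!L. L \<in> \<L> \<and> p i \<in> L \<and> p j \<in> L)) \<and>
     (\<forall>L\<in>\<L>. card (L \<inter> p ` {..<n}) = 2)"

definition line_of :: "(nat \<Rightarrow> complex) \<Rightarrow> complex set set \<Rightarrow> nat \<Rightarrow> nat \<Rightarrow> complex set" where
  "line_of p \<L> i j = (THE L. L \<in> \<L> \<and> p i \<in> L \<and> p j \<in> L)"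

definition seg :: "(nat \<Rightarrow> complex) \<Rightarrow> complex set set \<Rightarrow> nat \<Rightarrow> nat \<Rightarrow> complex set" where
  "seg p \<L> i j = pl_segment (line_of p \<L> i j) (p i) (p j)"

definition edge :: "nat \<Rightarrow> (nat \<Rightarrow> complex) \<Rightarrow> complex set set \<Rightarrow> nat \<Rightarrow> complex set" where
  "edge n p \<L> i = seg p \<L> i ((i + 1) mod n)"

definition poly_boundary :: "nat \<Rightarrow> (nat \<Rightarrow> complex) \<Rightarrow> complex set set \<Rightarrow> complex set" where
  "poly_boundary n p \<L> = (\<Union>i<n. edge n p \<L> i)"

definition counterclockwise :: "nat \<Rightarrow> (nat \<Rightarrow> complex) \<Rightarrow> complex set set \<Rightarrow> bool" where
  "counterclockwise n p \<L> \<longleftrightarrow>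
     (\<exists>g \<tau>. simple_path g \<and> pathfinish g = pathstart g \<and> path_image g = poly_boundary n p \<L> \<and>
        \<tau> 0 = 0 \<and> \<tau> n = 1 \<and>
        (\<forall>i<n. \<tau> i < \<tau> (Suc i) \<and> g (\<tau> i) = p i \<and> g ` {\<tau> i..\<tau> (Suc i)} = edge n p \<L> i) \<and>
        (\<forall>z \<in> inside (poly_boundary n p \<L>). winding_number g z = 1))"

definition pseudo_polygon :: "nat \<Rightarrow> (nat \<Rightarrow> complex) \<Rightarrow> complex set set \<Rightarrow> bool" where
  "pseudo_polygon n p \<L> \<longleftrightarrow>
     pseudo_configuration n p \<L> \<and>
     (\<forall>i<n. edge n p \<L> i \<inter> edge n p \<L> ((i + 1) mod n) = {p ((i + 1) mod n)}) \<and>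
     (\<forall>i<n. \<forall>j<n. i \<noteq> j \<and> j \<noteq> (i + 1) mod n \<and> i \<noteq> (j + 1) mod n
        \<longrightarrow> edge n p \<L> i \<inter> edge n p \<L> j = {}) \<and>
     counterclockwise n p \<L>"


section \<open>Visibility and blockers\<close>

text \<open>The indices of the vertices and of the edges in \<open>\<partial>(p\<^sub>i, p\<^sub>j)\<close>, for \<open>i, j < n\<close>.\<close>

definition bd_vertices :: "nat \<Rightarrow> nat \<Rightarrow> nat \<Rightarrow> nat set" where
  "bd_vertices n i j = (\<lambda>d. (i + d) mod n) ` {..(n + j - i) mod n}"

definition bd_edges :: "nat \<Rightarrow> nat \<Rightarrow> nat \<Rightarrow> nat set" where
  "bd_edges n i j = (\<lambda>d. (i + d) mod n) ` {..<(n + j - i) mod n}"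

definition sees :: "nat \<Rightarrow> (nat \<Rightarrow> complex) \<Rightarrow> complex set set \<Rightarrow> nat \<Rightarrow> nat \<Rightarrow> bool" where
  "sees n p \<L> i j \<longleftrightarrow> seg p \<L> i j \<inter> outside (poly_boundary n p \<L>) = {}"

definition visible_pair :: "nat \<Rightarrow> (nat \<Rightarrow> complex) \<Rightarrow> complex set set \<Rightarrow> nat \<Rightarrow> nat \<Rightarrow> bool" where
  "visible_pair n p \<L> i j \<longleftrightarrow> i < n \<and> j < n \<and> i \<noteq> j \<and> sees n p \<L> i j"

definition invisible_pair :: "nat \<Rightarrow> (nat \<Rightarrow> complex) \<Rightarrow> complex set set \<Rightarrow> nat \<Rightarrow> nat \<Rightarrow> bool" where
  "invisible_pair n p \<L> i j \<longleftrightarrow> i < n \<and> j < n \<and> i \<noteq> j \<and> \<not> sees n p \<L> i j"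

text \<open>
  Moving from \<open>b\<close> along \<open>L\<close> away from \<open>a\<close>, the point \<open>x\<close> is where the polygon with outside \<open>Out\<close>
  is left for the first time: nothing up to \<open>x\<close> is outside, but every continuation past \<open>x\<close>
  meets the outside. If the ray is outside immediately after \<open>b\<close>, this point is \<open>b\<close> itself.
\<close>

definition first_exit_point ::
  "complex set \<Rightarrow> complex set \<Rightarrow> complex \<Rightarrow> complex \<Rightarrow> complex \<Rightarrow> bool" where
  "first_exit_point Out L a b x \<longleftrightarrow>
     x \<in> insert b (pl_ray L a b) \<and> pl_segment L b x \<inter> Out = {} \<and>
     (\<forall>y \<in> pl_ray L a b. x \<in> pl_segment L b y \<and> y \<noteq> x \<longrightarrow> pl_segment L x y \<inter> Out \<noteq> {})"

definition ray_exits_through ::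
  "nat \<Rightarrow> (nat \<Rightarrow> complex) \<Rightarrow> complex set set \<Rightarrow> nat \<Rightarrow> nat \<Rightarrow> nat \<Rightarrow> bool" where
  "ray_exits_through n p \<L> i k m \<longleftrightarrow>
     (\<exists>x \<in> edge n p \<L> m.
        first_exit_point (outside (poly_boundary n p \<L>)) (line_of p \<L> i k) (p i) (p k) x)"

definition designated_blocker ::
  "nat \<Rightarrow> (nat \<Rightarrow> complex) \<Rightarrow> complex set set \<Rightarrow> nat \<Rightarrow> nat \<Rightarrow> nat \<Rightarrow> bool" where
  "designated_blocker n p \<L> i j k \<longleftrightarrow>
     invisible_pair n p \<L> i j \<and> k < n \<and> k \<noteq> i \<and> k \<noteq> j \<and> sees n p \<L> i k \<and>
     (k \<in> bd_vertices n i j \<and> (\<exists>m \<in> bd_edges n j i. ray_exits_through n p \<L> i k m) \<or>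
      k \<in> bd_vertices n j i \<and> (\<exists>m \<in> bd_edges n i j. ray_exits_through n p \<L> i k m))"

end

theory Submission
  imports Defs
begin

text \<open>
  After rotating and possibly reflecting the indices, \<open>i = 0 < s < k < j\<close>, and the ray behind the blocker
  \<open>p k\<close> leaves the polygon at a point \<open>x\<close> of an edge \<open>m \<ge> j\<close>. Let \<open>K\<close> be the union of the subsegment from
  \<open>p 0\<close> to \<open>x\<close> and the part of the boundary from \<open>x\<close> to \<open>p 0\<close>. By Janiszewski's theorem, a pseudo-line
  crossing the chord from \<open>p 0\<close> to \<open>x\<close> passes from one component of \<open>- K\<close> to another one; on the other
  hand all boundary points off \<open>K\<close> lie in the same component. Two pseudo-lines cross only once, so
  no subsegment of another pseudo-line runs inside the polygon from the boundary strictly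
  between \<open>p 0\<close> and \<open>p k\<close> to the boundary strictly between \<open>p k\<close> and \<open>x\<close>. This shows that \<open>p s\<close> does
  not see \<open>p j\<close>, and that a blocker for \<open>(s, k)\<close> also blocks \<open>(s, j)\<close>. If \<open>p s\<close> sees \<open>p k\<close>, its ray behind
  \<open>p k\<close> enters the region bounded by \<open>K\<close> and can only leave through the boundary part of \<open>K\<close>.
\<close>

section \<open>Curves that are properly embedded in the plane\<close>

text \<open>The obstacle is that a crossing is given only through the components of the complement
  of a whole, unbounded pseudo-line, whereas visibility and exit points concern a bounded polygon.
  One transfer bridges the two: a crossing on a bounded piece of a pseudo-line remains a change of
  sides when the rest of the line is replaced by a compact connected set that joins the ends of the
  piece and misses the crossing. It is used with two closures: an edge closed by the remaining
  boundary, so that touching an edge without changing sides is impossible, and the chord closed by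
  boundary from the exit point on. The contradiction comes from two views of one arc. With respect
  to the crosscut from \<open>p 0\<close> to \<open>p k\<close> its ends lie on different boundary
  arcs, so the crosscut must be hit. Prolonged to the exit point, the same crosscut leaves both ends
  on one side, so it cannot be hit exactly once. The exit of the ray beyond \<open>p j\<close> is
  what makes this prolongation available.\<close>

lemma curve_param_cont:
  assumes "curve_param \<gamma> L" shows "continuous_on S \<gamma>"
  using assms continuous_on_subset unfolding curve_param_def by blast

lemma curve_param_eq_iff:
  assumes "curve_param \<gamma> L" shows "\<gamma> a = \<gamma> b \<longleftrightarrow> a = b"
  using assms unfolding curve_param_def by (auto dest: injD)

lemma curve_param_inj_on:
  assumes "curve_param \<gamma> L" shows "inj_on \<gamma> S"
  using assms unfolding curve_param_def by (auto intro: inj_on_subset)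

lemma curve_param_mem:
  assumes "curve_param \<gamma> L" shows "\<gamma> a \<in> L"
  using assms unfolding curve_param_def by auto

lemma curve_param_connected_image:
  assumes "curve_param \<gamma> L" "connected S" shows "connected (\<gamma> ` S)"
  using assms by (auto intro: connected_continuous_image curve_param_cont)

lemma curve_param_reverse:
  assumes "curve_param \<gamma> L" shows "curve_param (\<lambda>t. \<gamma> (- t)) L"
proof -
  have "continuous_on UNIV (\<lambda>t. \<gamma> (- t))"
    by (rule continuous_on_compose2[OF curve_param_cont[OF assms, of UNIV]]) (auto intro: continuous_intros)
  moreover have "inj (\<lambda>t. \<gamma> (- t))"
    using curve_param_eq_iff[OF assms] by (auto intro: injI)
  moreover have "range (\<lambda>t. \<gamma> (- t)) = range \<gamma>"
    by (metis (no_types) fun.set_map surj_def minus_minus rangeI image_image)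
  moreover have "filterlim (\<lambda>t. \<gamma> (- t)) at_infinity at_top" "filterlim (\<lambda>t. \<gamma> (- t)) at_infinity at_bot"
    using assms unfolding curve_param_def
    by (auto intro: filterlim_compose[OF _ filterlim_uminus_at_bot_at_top]
        filterlim_compose[OF _ filterlim_uminus_at_top_at_bot])
  ultimately show ?thesis
    using assms unfolding curve_param_def by auto
qed

lemma curve_param_proper:
  assumes "curve_param \<gamma> L"
  obtains T where "\<And>s. norm (\<gamma> s) \<le> R \<Longrightarrow> \<bar>s\<bar> \<le> T"
proof -
  have "filterlim \<gamma> at_infinity at_top" "filterlim \<gamma> at_infinity at_bot"
    using assms unfolding curve_param_def by blast+
  \<comment> \<open>\<open>filterlim_at_infinity\<close> speaks of positive radii only, hence the
    maximum with 1; the radius still exceeds \<open>R\<close>.\<close>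
  moreover have "(0::real) < max 1 (R + 1)" by simp
  ultimately have "eventually (\<lambda>s. norm (\<gamma> s) \<ge> max 1 (R + 1)) at_top"
      "eventually (\<lambda>s. norm (\<gamma> s) \<ge> max 1 (R + 1)) at_bot"
    unfolding filterlim_at_infinity[OF order_refl] by blast+
  then obtain a b where a: "\<And>s. s \<ge> a \<Longrightarrow> norm (\<gamma> s) \<ge> max 1 (R + 1)"
    and b: "\<And>s. s \<le> b \<Longrightarrow> norm (\<gamma> s) \<ge> max 1 (R + 1)"
    unfolding eventually_at_top_linorder eventually_at_bot_linorder by blast
  show thesis
  proof (rule that)
    fix s assume "norm (\<gamma> s) \<le> R"
    then have "\<not> s \<ge> a" "\<not> s \<le> b" using a[of s] b[of s] by auto
    then show "\<bar>s\<bar> \<le> \<bar>a\<bar> + \<bar>b\<bar>" by auto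
  qed
qed

text \<open>By properness only boundedly many parameters reach a given ball, so the image meets each
  closed ball around 0 in a compact set; a limit point is caught by a slightly larger ball.\<close>

lemma curve_param_closed_image:
  assumes g: "curve_param \<gamma> L" and "closed S"
  shows "closed (\<gamma> ` S)"
proof -
  have "compact (\<gamma> ` S \<inter> cball 0 R)" for R
  proof -
    obtain T where T: "\<And>s. norm (\<gamma> s) \<le> R \<Longrightarrow> \<bar>s\<bar> \<le> T"
      using curve_param_proper[OF g] by metis
    have "\<gamma> ` S \<inter> cball 0 R = \<gamma> ` (S \<inter> {-T..T}) \<inter> cball 0 R"
      using T by (fastforce simp: abs_le_iff)
    moreover have "compact (\<gamma> ` (S \<inter> {-T..T}))"
      using \<open>closed S\<close> by (intro compact_continuous_image curve_param_cont[OF g] closed_Int_compact) auto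
    ultimately show ?thesis
      by (auto intro: compact_Int_closed)
  qed
  then have *: "closed (\<gamma> ` S \<inter> cball 0 R)" for R
    using compact_imp_closed by blast
  have "y \<in> \<gamma> ` S" if "y \<in> closure (\<gamma> ` S)" for y
  proof -
    have "y \<in> closure (ball 0 (norm y + 1) \<inter> \<gamma> ` S)"
      using open_Int_closure_subset[of "ball 0 (norm y + 1)" "\<gamma> ` S"] that by auto
    also have "\<dots> \<subseteq> \<gamma> ` S \<inter> cball 0 (norm y + 1)"
      using * by (intro closure_minimal) auto
    finally show ?thesis by auto
  qed
  then show ?thesis
    using closure_subset_eq by blast
qed

text \<open>The inverse of \<open>\<gamma>\<close> is continuous on compact pieces of the curve, and
  properness puts the other segment into one such piece. The preimage of that segment is then
  connected and contains \<open>r\<close> and \<open>t\<close>, hence everything between them. This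
  lets one fixed parametrisation compute \<open>pl_segment\<close>.\<close>

lemma curve_param_segment_subset:
  assumes g: "curve_param \<gamma> L" and g': "curve_param \<gamma>' L"
    and "\<gamma> r = \<gamma>' r'" "\<gamma> t = \<gamma>' t'"
  shows "\<gamma> ` closed_segment r t \<subseteq> \<gamma>' ` closed_segment r' t'"
proof -
  define K where "K = \<gamma>' ` closed_segment r' t'"
  define h where "h = inv_into UNIV \<gamma>"
  have hg: "h (\<gamma> s) = s" for s
    using g unfolding h_def curve_param_def by simp
  have K: "compact K" "connected K" "\<gamma> r \<in> K" "\<gamma> t \<in> K"
    using assms unfolding K_def
    by (auto intro: compact_continuous_image connected_continuous_image curve_param_cont[OF g'])
  obtain R where R: "\<And>z. z \<in> K \<Longrightarrow> norm z \<le> R"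
    using compact_imp_bounded[OF K(1)] bounded_iff by metis
  obtain T where T: "\<And>s. norm (\<gamma> s) \<le> R \<Longrightarrow> \<bar>s\<bar> \<le> T"
    using curve_param_proper[OF g] by metis
  have "K \<subseteq> \<gamma> ` {-T..T}"
  proof
    fix z assume "z \<in> K"
    then have "z \<in> L" unfolding K_def using curve_param_mem[OF g'] by auto
    then obtain s where "z = \<gamma> s" using g unfolding curve_param_def by auto
    with T[of s] R[OF \<open>z \<in> K\<close>] show "z \<in> \<gamma> ` {-T..T}" by (auto simp: abs_le_iff)
  qed
  moreover have "continuous_on (\<gamma> ` {-T..T}) h"
    by (rule continuous_on_inv) (auto simp: hg intro: curve_param_cont[OF g])
  ultimately have "connected (h ` K)"
    using K(2) by (meson connected_continuous_image continuous_on_subset)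
  moreover have "r \<in> h ` K" "t \<in> h ` K"
    using K(3,4) hg by (metis image_eqI)+
  ultimately have "closed_segment r t \<subseteq> h ` K"
    using connected_contains_Icc[of "h ` K"] by (auto simp: closed_segment_eq_real_ivl)
  moreover have "\<gamma> ` h ` K \<subseteq> K"
    using \<open>K \<subseteq> \<gamma> ` {-T..T}\<close> hg by force
  ultimately show ?thesis
    unfolding K_def by blast
qed

lemma pl_segment_param:
  assumes "curve_param \<gamma> L"
  shows "pl_segment L (\<gamma> r) (\<gamma> t) = \<gamma> ` closed_segment r t"
proof
  show "pl_segment L (\<gamma> r) (\<gamma> t) \<subseteq> \<gamma> ` closed_segment r t"
    unfolding pl_segment_def using curve_param_segment_subset[OF _ assms] by blast
  show "\<gamma> ` closed_segment r t \<subseteq> pl_segment L (\<gamma> r) (\<gamma> t)"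
    unfolding pl_segment_def using assms by blast
qed

lemma pl_segment_commute: "pl_segment L a b = pl_segment L b a"
  unfolding pl_segment_def by (subst closed_segment_commute) blast

lemma pl_ray_param:
  assumes g: "curve_param \<gamma> L" and "r < t"
  shows "pl_ray L (\<gamma> r) (\<gamma> t) = \<gamma> ` {t<..}"
proof -
  have "z \<in> pl_ray L (\<gamma> r) (\<gamma> t) \<longleftrightarrow> z \<in> \<gamma> ` {t<..}" for z
  proof (cases "z \<in> L")
    case True
    then obtain s where "z = \<gamma> s" using g unfolding curve_param_def by auto
    then show ?thesis
      using \<open>r < t\<close> curve_param_mem[OF g] curve_param_eq_iff[OF g]
      unfolding pl_ray_def by (auto simp: pl_segment_param[OF g] image_iff closed_segment_eq_real_ivl)
  qed (auto simp: pl_ray_def curve_param_mem[OF g])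
  then show ?thesis by blast
qed

lemma first_exit_point_param:
  assumes g: "curve_param \<gamma> L" and "r < t"
  shows "first_exit_point Out L (\<gamma> r) (\<gamma> t) x \<longleftrightarrow>
     (\<exists>w\<ge>t. x = \<gamma> w \<and> \<gamma> ` {t..w} \<inter> Out = {} \<and> (\<forall>v>w. \<gamma> ` {w..v} \<inter> Out \<noteq> {}))"
proof -
  have 1: "x \<in> insert (\<gamma> t) (\<gamma> ` {t<..}) \<longleftrightarrow> (\<exists>w\<ge>t. x = \<gamma> w)"
    by (force simp: le_less)
  have 2: "first_exit_point Out L (\<gamma> r) (\<gamma> t) (\<gamma> w) \<longleftrightarrow>
     \<gamma> ` {t..w} \<inter> Out = {} \<and> (\<forall>v>w. \<gamma> ` {w..v} \<inter> Out \<noteq> {})" if "w \<ge> t" for w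
  proof -
    have "\<gamma> w \<in> insert (\<gamma> t) (\<gamma> ` {t<..})" using that by (cases "w = t") auto
    moreover have "closed_segment t w = {t..w}" using that by (simp add: closed_segment_eq_real_ivl)
    moreover have "(\<forall>y \<in> \<gamma> ` {t<..}. \<gamma> w \<in> pl_segment L (\<gamma> t) y \<and> y \<noteq> \<gamma> w \<longrightarrow> pl_segment L (\<gamma> w) y \<inter> Out \<noteq> {})
      \<longleftrightarrow> (\<forall>v>w. \<gamma> ` {w..v} \<inter> Out \<noteq> {})" (is "?A \<longleftrightarrow> ?B")
    proof
      assume ?A
      show ?B
      proof (intro allI impI)
        fix v assume "v > w"
        then have "\<gamma> w \<in> pl_segment L (\<gamma> t) (\<gamma> v)" "\<gamma> v \<noteq> \<gamma> w" "\<gamma> v \<in> \<gamma> ` {t<..}"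
          using that by (auto simp: pl_segment_param[OF g] curve_param_eq_iff[OF g] closed_segment_eq_real_ivl)
        with \<open>?A\<close> have "pl_segment L (\<gamma> w) (\<gamma> v) \<inter> Out \<noteq> {}" by blast
        then show "\<gamma> ` {w..v} \<inter> Out \<noteq> {}"
          using \<open>v > w\<close> by (simp add: pl_segment_param[OF g] closed_segment_eq_real_ivl)
      qed
    next
      assume ?B
      show ?A
      proof (intro ballI impI)
        fix y assume "y \<in> \<gamma> ` {t<..}" and y: "\<gamma> w \<in> pl_segment L (\<gamma> t) y \<and> y \<noteq> \<gamma> w"
        then obtain v where "v > t" "y = \<gamma> v" by auto
        moreover from this y have "v > w"
          by (auto simp: pl_segment_param[OF g] curve_param_eq_iff[OF g] image_iff closed_segment_eq_real_ivl)
        ultimately show "pl_segment L (\<gamma> w) y \<inter> Out \<noteq> {}"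
          using \<open>?B\<close> by (auto simp: pl_segment_param[OF g] closed_segment_eq_real_ivl)
      qed
    qed
    ultimately show ?thesis
      unfolding first_exit_point_def pl_ray_param[OF assms] by (simp add: pl_segment_param[OF g])
  qed
  show ?thesis
  proof (cases "\<exists>w\<ge>t. x = \<gamma> w")
    case True
    then obtain w where "w \<ge> t" "x = \<gamma> w" by blast
    then show ?thesis using 2[of w] by (auto simp: curve_param_eq_iff[OF g])
  next
    case False
    then show ?thesis using 1 unfolding first_exit_point_def pl_ray_param[OF assms] by blast
  qed
qed

lemma curve_param_arc:
  assumes g: "curve_param \<gamma> L" and "r < t"
  obtains c where "arc c" "path_image c = \<gamma> ` {r..t}" "pathstart c = \<gamma> r" "pathfinish c = \<gamma> t"
proof
  show "arc (\<gamma> \<circ> linepath r t)"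
    unfolding arc_def
  proof
    show "path (\<gamma> \<circ> linepath r t)"
      by (intro path_continuous_image curve_param_cont[OF g]) simp
    show "inj_on (\<gamma> \<circ> linepath r t) {0..1}"
      using arc_linepath[of r t] \<open>r < t\<close>
      by (intro comp_inj_on curve_param_inj_on[OF g]) (auto simp: arc_def)
  qed
  show "path_image (\<gamma> \<circ> linepath r t) = \<gamma> ` {r..t}"
    using \<open>r < t\<close> by (simp add: path_image_compose closed_segment_eq_real_ivl)
qed (simp_all add: pathstart_compose pathfinish_compose)


section \<open>Crossings\<close>

text \<open>Turns the local condition, stated for some parametrisation, into a global one for any.
  Both halves of \<open>M\<close> off \<open>x\<close> are connected and miss \<open>L\<close>; if
  one point of each were connected in \<open>- L\<close>, all of \<open>M\<close> except
  \<open>x\<close> would lie in one component, against \<open>C \<noteq> D\<close>.\<close>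

lemma crosses_at_separates:
  assumes cr: "crosses_at M L x" and LM: "L \<inter> M = {x}"
    and d: "curve_param \<delta> M" "\<delta> u = x" and "a < u" "u < b"
  shows "\<not> connected_component (- L) (\<delta> a) (\<delta> b)"
proof
  assume ab: "connected_component (- L) (\<delta> a) (\<delta> b)"
  obtain \<gamma> t \<epsilon> C D where g: "curve_param \<gamma> M" "\<gamma> t = x" "\<epsilon> > 0"
    and CD: "C \<in> components (- L)" "D \<in> components (- L)" "C \<noteq> D"
    and gC: "\<gamma> ` {t - \<epsilon><..<t} \<subseteq> C" and gD: "\<gamma> ` {t<..<t + \<epsilon>} \<subseteq> D"
    using cr unfolding crosses_at_def by blast
  have "\<delta> c \<notin> L" if "c \<noteq> u" for c
    using that LM d(2) curve_param_mem[OF d(1)] curve_param_eq_iff[OF d(1)] by (metis IntI singletonD)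
  then have "\<delta> ` {..<u} \<subseteq> - L" "\<delta> ` {u<..} \<subseteq> - L"
    by auto
  then have conn: "connected_component (- L) (\<delta> a) (\<delta> c)" if "c \<noteq> u" for c
  proof (cases "c < u")
    case True
    have "connected (\<delta> ` {..<u})" by (simp add: curve_param_connected_image[OF d(1)])
    then show ?thesis
      using \<open>\<delta> ` {..<u} \<subseteq> - L\<close> True \<open>a < u\<close> by (intro connected_componentI[of "\<delta> ` {..<u}"]) auto
  next
    case False
    have "connected (\<delta> ` {u<..})" by (simp add: curve_param_connected_image[OF d(1)])
    then have "connected_component (- L) (\<delta> b) (\<delta> c)"
      using \<open>\<delta> ` {u<..} \<subseteq> - L\<close> False that \<open>u < b\<close> by (intro connected_componentI[of "\<delta> ` {u<..}"]) auto
    then show ?thesis using ab connected_component_trans by metis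
  qed
  have C: "\<gamma> (t - \<epsilon> / 2) \<in> C" and D: "\<gamma> (t + \<epsilon> / 2) \<in> D"
    using \<open>\<epsilon> > 0\<close> by (auto intro!: gC[THEN subsetD] gD[THEN subsetD])
  have "connected_component (- L) (\<delta> a) (\<gamma> s)" if "s \<noteq> t" for s
  proof -
    have "\<gamma> s \<in> M" "\<gamma> s \<noteq> \<delta> u"
      using that g d curve_param_mem[OF g(1)] curve_param_eq_iff[OF g(1)] by metis+
    then obtain c where "\<gamma> s = \<delta> c" "c \<noteq> u" using d unfolding curve_param_def by auto
    then show ?thesis using conn by simp
  qed
  from this[of "t - \<epsilon> / 2"] this[of "t + \<epsilon> / 2"]
  have "connected_component (- L) (\<gamma> (t - \<epsilon> / 2)) (\<gamma> (t + \<epsilon> / 2))"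
    using \<open>\<epsilon> > 0\<close> by (auto intro: connected_component_trans connected_component_sym)
  then have "C = D"
    using CD C D by (metis components_iff connected_component_eq mem_Collect_eq)
  with CD show False by simp
qed

text \<open>
  If \<open>A \<union> B\<close> did not separate the two sides of the crossing, then by Janiszewski's theorem
  neither would \<open>A \<union> B \<union> (L - A) \<supseteq> L\<close>, because \<open>B \<union> (L - A)\<close> stays away from the crossing.
\<close>

lemma crossing_separates_locally:
  assumes cr: "crosses_at M L (\<delta> u)" and LM: "L \<inter> M = {\<delta> u}" and d: "curve_param \<delta> M"
    and g: "curve_param \<gamma> L" and u: "\<delta> u \<in> \<gamma> ` {r<..<t}"
    and B: "compact B" "connected B" "\<gamma> r \<in> B" "\<gamma> t \<in> B" "\<delta> u \<notin> B"
  obtains \<epsilon> where "\<epsilon> > 0"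
    "\<And>a b. u - \<epsilon> < a \<Longrightarrow> a < u \<Longrightarrow> u < b \<Longrightarrow> b < u + \<epsilon> \<Longrightarrow>
       \<delta> a \<notin> \<gamma> ` {r..t} \<union> B \<and> \<delta> b \<notin> \<gamma> ` {r..t} \<union> B \<and>
       \<not> connected_component (- (\<gamma> ` {r..t} \<union> B)) (\<delta> a) (\<delta> b)"
proof -
  define J where "J = \<gamma> ` {r..t} \<union> B"
  define T where "T = \<gamma> ` ({..r} \<union> {t..}) \<union> B"
  obtain v where v: "\<delta> u = \<gamma> v" "r < v" "v < t" using u by auto
  have "compact J"
    unfolding J_def using B(1) by (auto intro: compact_continuous_image curve_param_cont[OF g])
  have "closed T"
    unfolding T_def using B(1) compact_imp_closed
    by (intro closed_Un curve_param_closed_image[OF g]) auto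
  have "L \<subseteq> J \<union> T"
  proof
    fix z assume "z \<in> L"
    then obtain s where "z = \<gamma> s" using g unfolding curve_param_def by auto
    then show "z \<in> J \<union> T" unfolding J_def T_def by (cases "s < r"; cases "s > t") auto
  qed
  \<comment> \<open>The two parts of \<open>L\<close> share only their end points, which belong to
    \<open>B\<close>; so \<open>J \<inter> T\<close> is exactly the connected set \<open>B\<close>,
    as Janiszewski's theorem requires.\<close>
  have "\<gamma> ` {r..t} \<inter> \<gamma> ` ({..r} \<union> {t..}) \<subseteq> B"
    using B(3,4) by (auto simp: curve_param_eq_iff[OF g])
  then have JT: "J \<inter> T = B"
    unfolding J_def T_def by auto
  have "\<delta> u \<notin> T"
    unfolding T_def using v B(5) by (auto simp: curve_param_eq_iff[OF g])
  then obtain e where e: "e > 0" "ball (\<delta> u) e \<subseteq> - T"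
    using \<open>closed T\<close> by (metis ComplI open_Compl openE)
  have "isCont \<delta> u"
    using curve_param_cont[OF d, of UNIV] by (simp add: continuous_on_eq_continuous_at)
  then obtain \<epsilon> where \<epsilon>: "\<epsilon> > 0" "\<And>a. \<bar>a - u\<bar> < \<epsilon> \<Longrightarrow> \<delta> a \<in> ball (\<delta> u) e"
    using e(1) unfolding continuous_at_eps_delta by (auto simp: dist_commute dist_real_def)
  show thesis
  proof (rule that[OF \<open>\<epsilon> > 0\<close>])
    fix a b assume ab: "u - \<epsilon> < a" "a < u" "u < b" "b < u + \<epsilon>"
    then have ball: "\<delta> a \<in> ball (\<delta> u) e" "\<delta> b \<in> ball (\<delta> u) e"
      by (simp_all add: \<epsilon>(2) abs_less_iff del: mem_ball)
    then have "\<delta> a \<notin> T" "\<delta> b \<notin> T" using e(2) by auto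
    moreover have "\<delta> a \<notin> L" "\<delta> b \<notin> L"
      using LM ab curve_param_mem[OF d] curve_param_eq_iff[OF d] by (metis IntI less_irrefl singletonD)+
    ultimately have notJ: "\<delta> a \<notin> J" "\<delta> b \<notin> J"
      unfolding J_def T_def using curve_param_mem[OF g] by auto
    have "\<not> connected_component (- J) (\<delta> a) (\<delta> b)"
    proof
      assume "connected_component (- J) (\<delta> a) (\<delta> b)"
      moreover have "connected_component (- T) (\<delta> a) (\<delta> b)"
        using ball e(2) by (intro connected_componentI[of "ball (\<delta> u) e"]) auto
      ultimately have "connected_component (- (J \<union> T)) (\<delta> a) (\<delta> b)"
        using Janiszewski[OF \<open>compact J\<close> \<open>closed T\<close>] JT B(2) by simp
      then have "connected_component (- L) (\<delta> a) (\<delta> b)"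
        by (rule connected_component_of_subset) (use \<open>L \<subseteq> J \<union> T\<close> in auto)
      then show False
        using crosses_at_separates[OF cr LM d] ab by blast
    qed
    with notJ show "\<delta> a \<notin> \<gamma> ` {r..t} \<union> B \<and> \<delta> b \<notin> \<gamma> ` {r..t} \<union> B \<and>
       \<not> connected_component (- (\<gamma> ` {r..t} \<union> B)) (\<delta> a) (\<delta> b)"
      unfolding J_def by blast
  qed
qed

text \<open>The outside of \<open>J\<close> is connected and misses \<open>K\<close>, and each point
  of \<open>J\<close> is a limit of outside points. So a point off \<open>K\<close> that is not
  inside reaches the outside within a ball avoiding \<open>K\<close>.\<close>

lemma connected_component_off_subset:
  fixes g :: "real \<Rightarrow> complex"
  assumes g: "simple_path g" "pathfinish g = pathstart g" "J = path_image g"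
    and K: "closed K" "K \<subseteq> J \<union> inside J" and uv: "u \<notin> K" "u \<notin> inside J" "v \<notin> K" "v \<notin> inside J"
  shows "connected_component (- K) u v"
proof -
  note Jd = Jordan_inside_outside[OF g(1,2), folded g(3)]
  have *: "\<exists>w \<in> outside J. connected_component (- K) u w" if "u \<notin> K" "u \<notin> inside J" for u
  proof -
    obtain e where e: "e > 0" "ball u e \<subseteq> - K"
      using K(1) \<open>u \<notin> K\<close> by (metis ComplI open_Compl openE)
    have "u \<in> outside J \<or> u \<in> frontier (outside J)"
      using Jd \<open>u \<notin> inside J\<close> by blast
    then have "u \<in> closure (outside J)"
      using closure_subset by (auto simp: frontier_def)
    then obtain w where "w \<in> outside J" "dist w u < e"
      using e(1) closure_approachable by metis
    then show ?thesis
      using e by (intro bexI[of _ w] connected_componentI[of "ball u e"]) (auto simp: dist_commute)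
  qed
  obtain w w' where w: "w \<in> outside J" "connected_component (- K) u w"
    "w' \<in> outside J" "connected_component (- K) v w'"
    using *[OF uv(1,2)] *[OF uv(3,4)] by blast
  have "outside J \<subseteq> - K"
    using K(2) outside_no_overlap[of J] inside_Int_outside[of J] by blast
  then have "connected_component (- K) w w'"
    using Jd w by (intro connected_componentI[of "outside J"]) auto
  then show ?thesis
    using w by (metis connected_component_sym connected_component_trans)
qed

text \<open>The crosscut splits the inside into a region bounded by \<open>c1\<close> and
  \<open>c\<close> and one bounded by \<open>c2\<close> and \<open>c\<close>. A connected set
  avoiding \<open>c\<close> stays in one region, and the closure of that region misses the open arc
  belonging to the other.\<close>

lemma crosscut_separates:
  fixes c1 c2 c :: "real \<Rightarrow> complex"
  assumes "arc c1" "pathstart c1 = a" "pathfinish c1 = b"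
    and "arc c2" "pathstart c2 = a" "pathfinish c2 = b"
    and "arc c" "pathstart c = a" "pathfinish c = b"
    and c12: "path_image c1 \<inter> path_image c2 = {a, b}"
    and J: "J = path_image c1 \<union> path_image c2"
    and cin: "path_image c - {a, b} \<subseteq> inside J"
    and S: "connected S" "S \<subseteq> inside J" "u \<in> closure S" "v \<in> closure S"
    and u: "u \<in> path_image c1 - {a, b}" and v: "v \<in> path_image c2 - {a, b}"
  shows "S \<inter> path_image c \<noteq> {}"
proof
  assume Sc: "S \<inter> path_image c = {}"
  have "a \<noteq> b" using assms(1-3) arc_distinct_ends by fastforce
  have ab: "a \<in> path_image c1" "b \<in> path_image c1" "a \<in> path_image c2" "b \<in> path_image c2"
     "a \<in> path_image c" "b \<in> path_image c"
    using assms(1-9) by (metis pathfinish_in_path_image pathstart_in_path_image)+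
  have "inside J \<inter> J = {}" by (rule inside_no_overlap)
  then have c1c: "path_image c1 \<inter> path_image c = {a, b}" and c2c: "path_image c2 \<inter> path_image c = {a, b}"
    using cin ab J by blast+
  \<comment> \<open>The splitting theorem needs \<open>c\<close> to meet the inside; a connected arc
    cannot consist of its two ends only.\<close>
  have "path_image c \<noteq> {a, b}"
    using connected_arc_image[OF \<open>arc c\<close>] connected_finite_iff_sing[of "path_image c"] \<open>a \<noteq> b\<close> by auto
  then have ne: "path_image c \<inter> inside (path_image c1 \<union> path_image c2) \<noteq> {}"
    using cin ab J by blast
  define I1 where "I1 = inside (path_image c1 \<union> path_image c)"
  define I2 where "I2 = inside (path_image c2 \<union> path_image c)"
  have I: "I1 \<inter> I2 = {}" "I1 \<union> I2 \<union> (path_image c - {a, b}) = inside J"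
    by (rule split_inside_simple_closed_curve[OF arc_imp_simple_path[OF \<open>arc c1\<close>] assms(2,3)
        arc_imp_simple_path[OF \<open>arc c2\<close>] assms(5,6) arc_imp_simple_path[OF \<open>arc c\<close>] assms(8,9)
        \<open>a \<noteq> b\<close> c12 c1c c2c ne]; simp add: I1_def I2_def J)+
  have closed: "closed (path_image c1 \<union> path_image c)" "closed (path_image c2 \<union> path_image c)"
    using assms(1,4,7) by (auto simp: closed_arc_image)
  then have op: "open I1" "open I2"
    unfolding I1_def I2_def by (auto intro: open_inside)
  have cl: "closure I1 \<subseteq> I1 \<union> (path_image c1 \<union> path_image c)"
           "closure I2 \<subseteq> I2 \<union> (path_image c2 \<union> path_image c)"
    unfolding I1_def I2_def using closure_inside_subset[OF closed(1)] closure_inside_subset[OF closed(2)] by auto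
  have "S \<subseteq> I1 \<union> I2" using S(2) I Sc by blast
  then have "S \<inter> I1 = {} \<or> S \<inter> I2 = {}"
    using connectedD[OF S(1) op] I(1) by blast
  then have "S \<subseteq> I1 \<or> S \<subseteq> I2" using \<open>S \<subseteq> I1 \<union> I2\<close> by blast
  then have "closure S \<subseteq> I1 \<union> (path_image c1 \<union> path_image c) \<or>
             closure S \<subseteq> I2 \<union> (path_image c2 \<union> path_image c)"
    using cl closure_mono by blast
  moreover have "u \<notin> I2 \<union> (path_image c2 \<union> path_image c)" "v \<notin> I1 \<union> (path_image c1 \<union> path_image c)"
    using u v c12 c1c c2c I(2) \<open>inside J \<inter> J = {}\<close> J by blast+
  ultimately show False using S(3,4) by blast
qed


section \<open>Closed cycles of pseudo-segments\<close>

text \<open>The orientation of the boundary plays no role, which makes this notion invariant under reflection.\<close>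

locale edge_cycle =
  fixes n :: nat and p :: "nat \<Rightarrow> complex" and \<L> :: "complex set set"
  assumes config: "pseudo_configuration n p \<L>"
    and consecutive: "i < n \<Longrightarrow> edge n p \<L> i \<inter> edge n p \<L> ((i + 1) mod n) = {p ((i + 1) mod n)}"
    and disjoint: "i < n \<Longrightarrow> j < n \<Longrightarrow> i \<noteq> j \<Longrightarrow> j \<noteq> (i + 1) mod n \<Longrightarrow> i \<noteq> (j + 1) mod n
                     \<Longrightarrow> edge n p \<L> i \<inter> edge n p \<L> j = {}"
begin

abbreviation E :: "nat \<Rightarrow> complex set" where "E \<equiv> edge n p \<L>"
abbreviation J :: "complex set" where "J \<equiv> poly_boundary n p \<L>"

section \<open>Pseudo-lines, segments and edges of the cycle\<close>

lemma n_ge_3: "n \<ge> 3"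
  using config unfolding pseudo_configuration_def by blast

lemma arrangement: "pseudo_line_arrangement \<L>"
  using config by (simp add: pseudo_configuration_def)

lemma succ_mod: "m < n \<Longrightarrow> (m + 1) mod n = (if m + 1 = n then 0 else m + 1)"
  by auto

lemma succ_mod_props:
  assumes "m < n" shows "(m + 1) mod n < n" "(m + 1) mod n \<noteq> m"
  using assms n_ge_3 succ_mod[OF assms] by (auto split: if_splits)

lemma vertex_eq_iff: "i < n \<Longrightarrow> j < n \<Longrightarrow> p i = p j \<longleftrightarrow> i = j"
  using config unfolding pseudo_configuration_def by (auto simp: inj_on_def)

lemma line_ex1: "i < n \<Longrightarrow> j < n \<Longrightarrow> i \<noteq> j \<Longrightarrow> \<exists>!L. L \<in> \<L> \<and> p i \<in> L \<and> p j \<in> L"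
  using config unfolding pseudo_configuration_def by blast

lemma line_of_mem:
  assumes "i < n" "j < n" "i \<noteq> j"
  shows "line_of p \<L> i j \<in> \<L>" "p i \<in> line_of p \<L> i j" "p j \<in> line_of p \<L> i j"
  using theI'[OF line_ex1[OF assms]] unfolding line_of_def by auto

lemma line_of_commute: "line_of p \<L> i j = line_of p \<L> j i"
  unfolding line_of_def by (metis (no_types))

lemma seg_commute: "seg p \<L> i j = seg p \<L> j i"
  unfolding seg_def using line_of_commute pl_segment_commute by metis

lemma line_vertices:
  assumes "L \<in> \<L>" "i < n" "j < n" "i \<noteq> j" "p i \<in> L" "p j \<in> L" "l < n" "p l \<in> L"
  shows "l = i \<or> l = j"
proof (rule ccontr)
  assume "\<not> (l = i \<or> l = j)"
  then have "card {p i, p j, p l} = 3"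
    using assms vertex_eq_iff by auto
  moreover have "card (L \<inter> p ` {..<n}) = 2"
    using config \<open>L \<in> \<L>\<close> unfolding pseudo_configuration_def by blast
  moreover have "{p i, p j, p l} \<subseteq> L \<inter> p ` {..<n}"
    using assms by auto
  ultimately show False
    using card_mono[of "L \<inter> p ` {..<n}" "{p i, p j, p l}"] by auto
qed

lemma line_of_vertices:
  assumes "i < n" "j < n" "i \<noteq> j" "l < n" "p l \<in> line_of p \<L> i j"
  shows "l = i \<or> l = j"
  using line_vertices[OF line_of_mem(1)[OF assms(1-3)] assms(1-3) line_of_mem(2,3)[OF assms(1-3)] assms(4,5)] .

lemma line_of_neq:
  assumes "i < n" "j < n" "i \<noteq> j" "l < n" "h < n" "l \<noteq> h" "l \<noteq> i" "l \<noteq> j"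
  shows "line_of p \<L> l h \<noteq> line_of p \<L> i j"
  using line_of_vertices[OF assms(1-4)] line_of_mem(2)[OF assms(4-6)] assms(7,8) by metis

lemma line_param:
  assumes "L \<in> \<L>" "a \<in> L" "b \<in> L" "a \<noteq> b"
  obtains \<gamma> r t where "curve_param \<gamma> L" "r < t" "\<gamma> r = a" "\<gamma> t = b"
proof -
  obtain \<gamma> where g: "curve_param \<gamma> L"
    using arrangement \<open>L \<in> \<L>\<close> unfolding pseudo_line_arrangement_def pseudo_line_def by meson
  then obtain r t where rt: "\<gamma> r = a" "\<gamma> t = b"
    using assms(2,3) unfolding curve_param_def by blast
  show thesis
  proof (cases "r < t")
    case True
    then show thesis using that g rt by blast
  next
    case False
    moreover have "r \<noteq> t" using rt \<open>a \<noteq> b\<close> by auto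
    ultimately have "- r < - t" by auto
    then show thesis using that[OF curve_param_reverse[OF g], of "- r" "- t"] rt by simp
  qed
qed

lemma lines_meet:
  assumes "L \<in> \<L>" "M \<in> \<L>" "L \<noteq> M" "z \<in> L" "z \<in> M"
  shows "L \<inter> M = {z}" "crosses_at M L z"
proof -
  obtain x where "L \<inter> M = {x}" "crosses_at M L x"
    using arrangement assms(1-3) unfolding pseudo_line_arrangement_def by meson
  moreover from this have "x = z" using assms(4,5) by (metis IntI singletonD)
  ultimately show "L \<inter> M = {z}" "crosses_at M L z" by simp_all
qed

lemma seg_param:
  assumes "i < n" "j < n" "i \<noteq> j"
  obtains \<gamma> r t where "curve_param \<gamma> (line_of p \<L> i j)" "r < t" "\<gamma> r = p i" "\<gamma> t = p j"
    "seg p \<L> i j = \<gamma> ` {r..t}"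
proof -
  obtain \<gamma> r t where g: "curve_param \<gamma> (line_of p \<L> i j)" "r < t" "\<gamma> r = p i" "\<gamma> t = p j"
    using line_param[OF line_of_mem[OF assms]] vertex_eq_iff assms by metis
  moreover from this have "seg p \<L> i j = \<gamma> ` {r..t}"
    using pl_segment_param[OF g(1), of r t] unfolding seg_def by (simp add: closed_segment_eq_real_ivl)
  ultimately show thesis using that by blast
qed

lemma seg_param_eq:
  assumes "curve_param \<gamma> (line_of p \<L> i j)" "r < t" "\<gamma> r = p i" "\<gamma> t = p j"
  shows "seg p \<L> i j = \<gamma> ` {r..t}"
  using pl_segment_param[OF assms(1), of r t] assms(2-4) unfolding seg_def
  by (simp add: closed_segment_eq_real_ivl)

lemma seg_subset_line:
  assumes "i < n" "j < n" "i \<noteq> j" shows "seg p \<L> i j \<subseteq> line_of p \<L> i j"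
  unfolding seg_def pl_segment_def using curve_param_mem by blast

lemma edge_subset_line:
  assumes "m < n" shows "E m \<subseteq> line_of p \<L> m ((m + 1) mod n)"
  unfolding edge_def using seg_subset_line[OF assms succ_mod_props(1)[OF assms]] succ_mod_props(2)[OF assms] by simp

lemma edge_param:
  assumes "m < n"
  obtains \<gamma> r t where "curve_param \<gamma> (line_of p \<L> m ((m + 1) mod n))" "r < t" "\<gamma> r = p m"
    "\<gamma> t = p ((m + 1) mod n)" "E m = \<gamma> ` {r..t}"
  unfolding edge_def using seg_param[OF assms succ_mod_props(1)[OF assms] succ_mod_props(2)[OF assms, symmetric]] .

lemma vertex_mem_edge:
  assumes "l < n" "m < n" shows "p l \<in> E m \<longleftrightarrow> l = m \<or> l = (m + 1) mod n"
proof
  assume "p l \<in> E m"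
  then show "l = m \<or> l = (m + 1) mod n"
    using edge_subset_line[OF assms(2)] line_of_vertices[OF assms(2), of "(m + 1) mod n" l]
      succ_mod_props[OF assms(2)] assms by auto
next
  obtain \<gamma> r t where g: "curve_param \<gamma> (line_of p \<L> m ((m + 1) mod n))" "r < t" "\<gamma> r = p m"
    "\<gamma> t = p ((m + 1) mod n)" "E m = \<gamma> ` {r..t}"
    using edge_param[OF assms(2)] .
  then have "p m \<in> E m" "p ((m + 1) mod n) \<in> E m"
    unfolding g(3,4)[symmetric] g(5) by auto
  moreover assume "l = m \<or> l = (m + 1) mod n"
  ultimately show "p l \<in> E m" by auto
qed

lemma edges_meet:
  assumes "a < n" "b < n" "a \<noteq> b" "z \<in> E a" "z \<in> E b"
  shows "b = (a + 1) mod n \<and> z = p b \<or> a = (b + 1) mod n \<and> z = p a"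
  using assms consecutive[of a] consecutive[of b] disjoint[of a b] by blast

text \<open>A pseudo-line carries only two vertices, so an edge on \<open>line_of p \<L> i j\<close>
  has \<open>p i\<close> and \<open>p j\<close> as its ends. This later excludes that a diagonal or
  a ray runs along an edge instead of crossing it.\<close>

lemma edge_line_eq:
  assumes "i < n" "j < n" "i \<noteq> j" "m < n" "line_of p \<L> m ((m + 1) mod n) = line_of p \<L> i j"
  shows "m = i \<and> j = (i + 1) mod n \<or> m = j \<and> i = (j + 1) mod n" "E m = seg p \<L> i j"
proof -
  note m = succ_mod_props[OF \<open>m < n\<close>]
  have "m = i \<or> m = j" "(m + 1) mod n = i \<or> (m + 1) mod n = j"
    using line_of_vertices[OF assms(1-3)] line_of_mem[of m "(m + 1) mod n"] m assms by metis+
  then show 1: "m = i \<and> j = (i + 1) mod n \<or> m = j \<and> i = (j + 1) mod n"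
    using m(2) by auto
  then show "E m = seg p \<L> i j"
    unfolding edge_def using seg_commute by metis
qed

section \<open>The boundary as a closed curve composed of arcs\<close>

lemma edges_arc:
  assumes "0 < d" "d < n" "a < n"
  obtains c where "arc c" "path_image c = (\<Union>e<d. E ((a + e) mod n))"
    "pathstart c = p a" "pathfinish c = p ((a + d) mod n)"
proof -
  have "\<exists>c. arc c \<and> path_image c = (\<Union>e<d. E ((a + e) mod n)) \<and>
    pathstart c = p a \<and> pathfinish c = p ((a + d) mod n)"
    using assms(1,2)
  proof (induction d rule: nat_induct_non_zero)
    case 1
    obtain \<gamma> r t where g: "curve_param \<gamma> (line_of p \<L> a ((a + 1) mod n))" "r < t" "\<gamma> r = p a"
      "\<gamma> t = p ((a + 1) mod n)" "E a = \<gamma> ` {r..t}"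
      using edge_param[OF \<open>a < n\<close>] .
    obtain c where "arc c" "path_image c = \<gamma> ` {r..t}" "pathstart c = \<gamma> r" "pathfinish c = \<gamma> t"
      using curve_param_arc[OF g(1,2)] .
    then show ?case using g \<open>a < n\<close> by (intro exI[of _ c]) (simp add: lessThan_Suc)
  next
    case (Suc d)
    then obtain c where c: "arc c" "path_image c = (\<Union>e<d. E ((a + e) mod n))"
      "pathstart c = p a" "pathfinish c = p ((a + d) mod n)" by auto
    define b where "b = (a + d) mod n"
    have "b < n" unfolding b_def using n_ge_3 by simp
    obtain \<gamma> r t where g: "curve_param \<gamma> (line_of p \<L> b ((b + 1) mod n))" "r < t" "\<gamma> r = p b"
      "\<gamma> t = p ((b + 1) mod n)" "E b = \<gamma> ` {r..t}"
      using edge_param[OF \<open>b < n\<close>] .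
    obtain c' where c': "arc c'" "path_image c' = \<gamma> ` {r..t}" "pathstart c' = \<gamma> r" "pathfinish c' = \<gamma> t"
      using curve_param_arc[OF g(1,2)] .
    have "z = p b" if "z \<in> E ((a + e) mod n)" "z \<in> E b" "e < d" for z e
    proof -
      \<comment> \<open>With \<open>f = 0\<close> the new edge is none of the old ones, with
        \<open>f = 1\<close> no old edge comes right after it; by \<open>edges_meet\<close> only the
        common point \<open>p b\<close> remains. The value \<open>f = 1\<close> is admissible
        because \<open>Suc d < n\<close>.\<close>
      have ne: "(a + e) mod n \<noteq> (a + d + f) mod n" if "f < n - d" for f
      proof
        assume "(a + e) mod n = (a + d + f) mod n"
        then have "n dvd (a + d + f) - (a + e)"
          using mod_eq_dvd_iff_nat[of "a + e" "a + d + f" n] \<open>e < d\<close> by auto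
        then show False
          using that \<open>e < d\<close> Suc.prems by (auto dest!: dvd_imp_le)
      qed
      have "(a + e) mod n \<noteq> b" "(a + e) mod n \<noteq> (b + 1) mod n"
        using ne[of 0] ne[of 1] Suc.prems unfolding b_def by (auto simp: mod_simps)
      then show ?thesis
        using edges_meet[of "(a + e) mod n" b z] that \<open>b < n\<close> n_ge_3 by auto
    qed
    then have "path_image c \<inter> path_image c' \<subseteq> {pathstart c'}"
      using c c' g by auto
    then have "arc (c +++ c')"
      using c c' g unfolding b_def by (intro arc_join) auto
    moreover have "path_image (c +++ c') = (\<Union>e<Suc d. E ((a + e) mod n))"
      using c c' g unfolding b_def by (subst path_image_join) (auto simp: lessThan_Suc)
    ultimately show ?case
      using c c' g unfolding b_def by (intro exI[of _ "c +++ c'"]) (auto simp: mod_simps)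
  qed
  then show thesis using that by blast
qed

text \<open>Admitting \<open>b = n\<close> allows an arc to close up at \<open>p 0\<close> without
  cyclic indices; \<open>b - a < n\<close> excludes the full boundary, which is no arc.\<close>

lemma boundary_arc:
  assumes "a < b" "b \<le> n" "b - a < n"
  obtains c where "arc c" "path_image c = (\<Union>e\<in>{a..<b}. E e)"
    "pathstart c = p a" "pathfinish c = p (b mod n)"
proof -
  obtain c where c: "arc c" "path_image c = (\<Union>e<b - a. E ((a + e) mod n))"
    "pathstart c = p a" "pathfinish c = p ((a + (b - a)) mod n)"
    using edges_arc[of "b - a" a] assms by auto
  have "(\<Union>e<b - a. E ((a + e) mod n)) = (\<Union>e\<in>{a..<b}. E e)"
  proof
    show "(\<Union>e<b - a. E ((a + e) mod n)) \<subseteq> (\<Union>e\<in>{a..<b}. E e)"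
      using assms by (auto intro!: bexI)
    show "(\<Union>e\<in>{a..<b}. E e) \<subseteq> (\<Union>e<b - a. E ((a + e) mod n))"
    proof
      fix z assume "z \<in> (\<Union>e\<in>{a..<b}. E e)"
      then obtain e where "a \<le> e" "e < b" "z \<in> E e" by auto
      then show "z \<in> (\<Union>e<b - a. E ((a + e) mod n))"
        using assms by (intro UN_I[of "e - a"]) auto
    qed
  qed
  then show thesis using that c assms by auto
qed

text \<open>Supplies the set \<open>B\<close> of \<open>crossing_separates_locally\<close> when the
  piece of the pseudo-line is an edge: the other \<open>n - 1\<close> edges form an arc from the far
  end of the edge back to its start.\<close>

lemma boundary_except_edge:
  assumes "m < n"
  shows "compact (\<Union>e\<in>{..<n} - {m}. E e)" "connected (\<Union>e\<in>{..<n} - {m}. E e)"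
    "p m \<in> (\<Union>e\<in>{..<n} - {m}. E e)" "p ((m + 1) mod n) \<in> (\<Union>e\<in>{..<n} - {m}. E e)"
proof -
  obtain c where c: "arc c" "path_image c = (\<Union>e<n - 1. E (((m + 1) mod n + e) mod n))"
    "pathstart c = p ((m + 1) mod n)" "pathfinish c = p (((m + 1) mod n + (n - 1)) mod n)"
    using edges_arc[of "n - 1" "(m + 1) mod n"] n_ge_3 by auto
  have "(\<lambda>e. ((m + 1) mod n + e) mod n) ` {..<n - 1} = {..<n} - {m}"
  proof
    show "(\<lambda>e. ((m + 1) mod n + e) mod n) ` {..<n - 1} \<subseteq> {..<n} - {m}"
    proof
      fix l assume "l \<in> (\<lambda>e. ((m + 1) mod n + e) mod n) ` {..<n - 1}"
      then obtain e where e: "e < n - 1" "l = ((m + 1) mod n + e) mod n" by auto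
      then have l: "l = (m + 1 + e) mod n" by (simp only: mod_add_left_eq)
      have "l \<noteq> m"
      proof
        assume "l = m"
        then have "n dvd (m + 1 + e) - m"
          using l mod_eq_dvd_iff_nat[of m "m + 1 + e" n] \<open>m < n\<close> by auto
        then show False using e by (auto dest!: dvd_imp_le)
      qed
      then show "l \<in> {..<n} - {m}" using l n_ge_3 by simp
    qed
    show "{..<n} - {m} \<subseteq> (\<lambda>e. ((m + 1) mod n + e) mod n) ` {..<n - 1}"
    proof
      fix l assume l: "l \<in> {..<n} - {m}"
      show "l \<in> (\<lambda>e. ((m + 1) mod n + e) mod n) ` {..<n - 1}"
      proof (cases "m < l")
        case True
        then show ?thesis using l \<open>m < n\<close>
          by (intro image_eqI[of _ _ "l - (m + 1)"]) (auto simp: mod_add_left_eq)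
      next
        case False
        then have "m + 1 + (n + l - (m + 1)) = n + l" using l \<open>m < n\<close> by simp
        then have "l = ((m + 1) mod n + (n + l - (m + 1))) mod n"
          using l by (simp only: mod_add_left_eq) simp
        moreover have "n + l - (m + 1) < n - 1" using l False \<open>m < n\<close> by auto
        ultimately show ?thesis by blast
      qed
    qed
  qed
  then have im: "path_image c = (\<Union>e\<in>{..<n} - {m}. E e)"
    using c(2) by (metis (no_types) image_image)
  have "((m + 1) mod n + (n - 1)) mod n = m"
  proof -
    have "((m + 1) mod n + (n - 1)) mod n = (m + 1 + (n - 1)) mod n" by (rule mod_add_left_eq)
    also have "\<dots> = (m + n) mod n" using \<open>m < n\<close> by simp
    finally show ?thesis using \<open>m < n\<close> by simp
  qed
  then show "compact (\<Union>e\<in>{..<n} - {m}. E e)" "connected (\<Union>e\<in>{..<n} - {m}. E e)"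
    "p m \<in> (\<Union>e\<in>{..<n} - {m}. E e)" "p ((m + 1) mod n) \<in> (\<Union>e\<in>{..<n} - {m}. E e)"
    using c unfolding im[symmetric]
    by (metis compact_arc_image connected_arc_image pathfinish_in_path_image pathstart_in_path_image)+
qed

lemma boundary_arcs_meet:
  assumes "0 < k" "k < n"
  shows "(\<Union>e\<in>{0..<k}. E e) \<inter> (\<Union>e\<in>{k..<n}. E e) = {p 0, p k}"
proof
  have *: "z = p 0 \<or> z = p k" if "a < k" "k \<le> b" "b < n" "z \<in> E a" "z \<in> E b" for a b z
  proof -
    have "b = a + 1 \<and> z = p b \<or> a = 0 \<and> z = p a"
      using edges_meet[of a b z] that succ_mod[of a] succ_mod[of b] by (auto split: if_splits)
    moreover have "k = b" if "b = a + 1" using that \<open>a < k\<close> \<open>k \<le> b\<close> by simp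
    ultimately show ?thesis by auto
  qed
  show "(\<Union>e\<in>{0..<k}. E e) \<inter> (\<Union>e\<in>{k..<n}. E e) \<subseteq> {p 0, p k}"
  proof (intro subsetI)
    fix z assume "z \<in> (\<Union>e\<in>{0..<k}. E e) \<inter> (\<Union>e\<in>{k..<n}. E e)"
    then obtain a b where "a \<in> {0..<k}" "z \<in> E a" "b \<in> {k..<n}" "z \<in> E b" by blast
    then show "z \<in> {p 0, p k}" using *[of a b z] by simp
  qed
  have "p 0 \<in> E 0" "p k \<in> E (k - 1)" "p 0 \<in> E (n - 1)" "p k \<in> E k"
    using assms vertex_mem_edge by auto
  moreover have k: "0 \<in> {0..<k}" "k - 1 \<in> {0..<k}" "n - 1 \<in> {k..<n}" "k \<in> {k..<n}"
    using assms by auto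
  ultimately show "{p 0, p k} \<subseteq> (\<Union>e\<in>{0..<k}. E e) \<inter> (\<Union>e\<in>{k..<n}. E e)"
    using k by blast
qed

lemma boundary_eq_Un:
  assumes "k \<le> n" shows "J = (\<Union>e\<in>{0..<k}. E e) \<union> (\<Union>e\<in>{k..<n}. E e)"
proof -
  have "{..<n} = {0..<k} \<union> {k..<n}" using assms by auto
  then show ?thesis unfolding poly_boundary_def by simp
qed

lemma edge_subset_boundary: "m < n \<Longrightarrow> E m \<subseteq> J"
  unfolding poly_boundary_def by auto

lemma vertex_mem_boundary: "l < n \<Longrightarrow> p l \<in> J"
  using vertex_mem_edge[of l l] edge_subset_boundary by blast

text \<open>A reflected labelling has no counterclockwise parametrisation to start from, so a loop
  is glued from the first edge and the arc of all the others.\<close>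

lemma boundary_loop:
  obtains g where "simple_path g" "pathfinish g = pathstart g" "path_image g = J"
proof -
  obtain c1 where c1: "arc c1" "path_image c1 = (\<Union>e\<in>{0..<1}. E e)" "pathstart c1 = p 0" "pathfinish c1 = p 1"
    by (rule boundary_arc[of 0 1]) (use n_ge_3 in simp_all)
  obtain c2 where c2: "arc c2" "path_image c2 = (\<Union>e\<in>{1..<n}. E e)" "pathstart c2 = p 1" "pathfinish c2 = p 0"
    by (rule boundary_arc[of 1 n]) (use n_ge_3 in simp_all)
  show thesis
  proof (rule that[of "c1 +++ c2"])
    show "simple_path (c1 +++ c2)"
      using c1 c2 boundary_arcs_meet[of 1] n_ge_3 by (intro simple_path_join_loop) auto
    show "path_image (c1 +++ c2) = J"
      using c1 c2 boundary_eq_Un[of 1] n_ge_3 by (simp add: path_image_join)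
  qed (use c1 c2 in auto)
qed

section \<open>Inside, outside and crossings of the boundary\<close>

lemma jordan:
  "open (inside J)" "connected (inside J)" "bounded (inside J)" "frontier (inside J) = J"
  "open (outside J)" "inside J \<union> outside J = - J"
  using boundary_loop Jordan_inside_outside by (metis (no_types))+

lemma inside_not_boundary: "z \<in> inside J \<Longrightarrow> z \<notin> J"
  using inside_no_overlap by blast

lemma inside_not_outside: "z \<in> inside J \<Longrightarrow> z \<notin> outside J"
  using inside_Int_outside by blast

lemma boundary_not_outside: "z \<in> J \<Longrightarrow> z \<notin> outside J"
  using outside_no_overlap by blast

text \<open>The edge is closed up by the other edges, which miss \<open>\<delta> u\<close> because
  distinct edges meet only in vertices. So a crossing of pseudo-lines on an open edge is a change of
  sides of the polygon.\<close>

lemma edge_crossing: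
  assumes M: "M \<in> \<L>" "curve_param \<delta> M" and m: "m < n" "M \<noteq> line_of p \<L> m ((m + 1) mod n)"
    and u: "\<delta> u \<in> E m" "\<delta> u \<notin> p ` {..<n}"
  obtains \<epsilon> where "\<epsilon> > 0"
    "\<And>a b. u - \<epsilon> < a \<Longrightarrow> a < u \<Longrightarrow> u < b \<Longrightarrow> b < u + \<epsilon> \<Longrightarrow>
       \<delta> a \<notin> J \<and> \<delta> b \<notin> J \<and> \<not> connected_component (- J) (\<delta> a) (\<delta> b)"
proof -
  define L where "L = line_of p \<L> m ((m + 1) mod n)"
  define B where "B = (\<Union>e\<in>{..<n} - {m}. E e)"
  obtain \<gamma> r t where g: "curve_param \<gamma> L" "r < t" "\<gamma> r = p m" "\<gamma> t = p ((m + 1) mod n)" "E m = \<gamma> ` {r..t}"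
    using edge_param[OF \<open>m < n\<close>] unfolding L_def .
  have L: "L \<in> \<L>" "L \<noteq> M" "\<delta> u \<in> L" "\<delta> u \<in> M"
    using line_of_mem(1)[of m "(m + 1) mod n"] succ_mod_props[OF m(1)] m edge_subset_line u
      curve_param_mem[OF M(2)] unfolding L_def by auto
  have J: "J = \<gamma> ` {r..t} \<union> B"
    unfolding g(5)[symmetric] B_def poly_boundary_def using \<open>m < n\<close> by auto
  have "\<delta> u \<noteq> \<gamma> r" "\<delta> u \<noteq> \<gamma> t"
    using g(3,4) u(2) succ_mod_props[OF m(1)] m(1) by auto
  then have "\<delta> u \<in> \<gamma> ` {r<..<t}"
    using u(1) unfolding g(5) by (auto simp: le_less)
  moreover have "\<delta> u \<notin> B"
  proof
    assume "\<delta> u \<in> B"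
    then obtain e where e: "e < n" "e \<noteq> m" "\<delta> u \<in> E e" unfolding B_def by auto
    then show False using edges_meet[OF m(1) e(1) e(2)[symmetric] u(1)] u(2) m(1) by auto
  qed
  moreover have "compact B" "connected B" "\<gamma> r \<in> B" "\<gamma> t \<in> B"
    unfolding B_def g(3,4) using boundary_except_edge[OF m(1)] by auto
  ultimately show thesis
    using crossing_separates_locally[OF lines_meet(2)[OF L(1) M(1) L(2,3,4)] lines_meet(1)[OF L(1) M(1) L(2,3,4)] M(2) g(1)]
      that unfolding J by (metis (no_types))
qed

text \<open>A boundary point on the arc would be a crossing of an edge, with points in different
  components of \<open>- J\<close> just before and after it; but neither may be outside, and the
  inside is connected.\<close>

lemma subset_insideI:
  assumes M: "M \<in> \<L>" "curve_param \<delta> M" and out: "\<delta> ` {a<..<b} \<inter> outside J = {}"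
    and u: "\<And>u. a < u \<Longrightarrow> u < b \<Longrightarrow> \<delta> u \<notin> p ` {..<n}"
      "\<And>u m. a < u \<Longrightarrow> u < b \<Longrightarrow> m < n \<Longrightarrow> \<delta> u \<in> E m \<Longrightarrow> M \<noteq> line_of p \<L> m ((m + 1) mod n)"
  shows "\<delta> ` {a<..<b} \<subseteq> inside J"
proof
  fix z assume "z \<in> \<delta> ` {a<..<b}"
  then obtain u where z: "z = \<delta> u" "a < u" "u < b" by auto
  show "z \<in> inside J"
  proof (rule ccontr)
    assume "z \<notin> inside J"
    moreover have "z \<notin> outside J" using out \<open>z \<in> \<delta> ` {a<..<b}\<close> by blast
    ultimately have "z \<in> J" using jordan(6) by blast
    then obtain m where m: "m < n" "\<delta> u \<in> E m" unfolding poly_boundary_def z by auto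
    obtain \<epsilon> where \<epsilon>: "\<epsilon> > 0"
      "\<And>c d. u - \<epsilon> < c \<Longrightarrow> c < u \<Longrightarrow> u < d \<Longrightarrow> d < u + \<epsilon> \<Longrightarrow>
         \<delta> c \<notin> J \<and> \<delta> d \<notin> J \<and> \<not> connected_component (- J) (\<delta> c) (\<delta> d)"
      using edge_crossing[OF M m(1) u(2)[OF z(2,3) m] m(2) u(1)[OF z(2,3)]] by blast
    obtain c where c: "max a (u - \<epsilon>) < c" "c < u" using dense[of "max a (u - \<epsilon>)" u] \<epsilon>(1) z by auto
    obtain d where d: "u < d" "d < min b (u + \<epsilon>)" using dense[of u "min b (u + \<epsilon>)"] \<epsilon>(1) z by auto
    have cd: "\<delta> c \<notin> J" "\<delta> d \<notin> J" "\<not> connected_component (- J) (\<delta> c) (\<delta> d)"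
      using \<epsilon>(2)[of c d] c d by auto
    moreover have "\<delta> c \<in> \<delta> ` {a<..<b}" "\<delta> d \<in> \<delta> ` {a<..<b}"
      using c d z by auto
    then have "\<delta> c \<notin> outside J" "\<delta> d \<notin> outside J"
      using out by blast+
    ultimately have "\<delta> c \<in> inside J" "\<delta> d \<in> inside J" using jordan(6) by blast+
    then have "connected_component (- J) (\<delta> c) (\<delta> d)"
      using jordan(2) inside_not_boundary by (intro connected_componentI[of "inside J"]) auto
    with cd show False by simp
  qed
qed

section \<open>Diagonals and rays\<close>

lemma vertex_on_line_param:
  assumes ij: "i < n" "j < n" "i \<noteq> j"
    and g: "curve_param \<gamma> (line_of p \<L> i j)" "\<gamma> r = p i" "\<gamma> t = p j" and u: "\<gamma> u \<in> p ` {..<n}"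
  shows "u = r \<or> u = t"
proof -
  obtain l where "l < n" "\<gamma> u = p l" using u by auto
  then have "\<gamma> u = \<gamma> r \<or> \<gamma> u = \<gamma> t"
    using line_of_vertices[OF ij, of l] curve_param_mem[OF g(1), of u] g(2,3) by auto
  then show ?thesis by (simp add: curve_param_eq_iff[OF g(1)])
qed

text \<open>\<open>sees\<close> tolerates contact with the boundary. Between non-adjacent vertices
  the segment is no edge and passes no third vertex, so any contact would be a crossing and lead
  outside.\<close>

lemma visible_interior:
  assumes ij: "i < n" "j < n" "i \<noteq> j" "j \<noteq> (i + 1) mod n" "i \<noteq> (j + 1) mod n" and vis: "sees n p \<L> i j"
    and g: "curve_param \<gamma> (line_of p \<L> i j)" "r < t" "\<gamma> r = p i" "\<gamma> t = p j"
  shows "\<gamma> ` {r<..<t} \<subseteq> inside J"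
proof (rule subset_insideI[OF line_of_mem(1)[OF ij(1-3)] g(1)])
  have "\<gamma> ` {r..t} \<inter> outside J = {}"
    using vis seg_param_eq[OF g] unfolding sees_def by simp
  moreover have "\<gamma> ` {r<..<t} \<subseteq> \<gamma> ` {r..t}" by auto
  ultimately show "\<gamma> ` {r<..<t} \<inter> outside J = {}" by blast
  show "\<gamma> u \<notin> p ` {..<n}" if "r < u" "u < t" for u
    using vertex_on_line_param[OF ij(1-3) g(1,3,4), of u] that by auto
  show "line_of p \<L> i j \<noteq> line_of p \<L> m ((m + 1) mod n)" if "m < n" for m
    using edge_line_eq(1)[OF ij(1-3) that] ij(4,5) by metis
qed

lemma ray_not_vertex:
  assumes ij: "i < n" "j < n" "i \<noteq> j"
    and g: "curve_param \<gamma> (line_of p \<L> i j)" "r < t" "\<gamma> r = p i" "\<gamma> t = p j" and "t < u"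
  shows "\<gamma> u \<notin> p ` {..<n}"
  using vertex_on_line_param[OF ij g(1,3,4), of u] \<open>t < u\<close> g(2) by auto

text \<open>An edge on the same pseudo-line would be the segment from \<open>p i\<close> to
  \<open>p j\<close>, which ends at parameter \<open>t\<close>, before \<open>u\<close>.\<close>

lemma ray_edge_line:
  assumes ij: "i < n" "j < n" "i \<noteq> j"
    and g: "curve_param \<gamma> (line_of p \<L> i j)" "r < t" "\<gamma> r = p i" "\<gamma> t = p j" and "t < u"
    and m: "m < n" "\<gamma> u \<in> E m"
  shows "line_of p \<L> i j \<noteq> line_of p \<L> m ((m + 1) mod n)"
proof
  assume "line_of p \<L> i j = line_of p \<L> m ((m + 1) mod n)"
  then have "E m = \<gamma> ` {r..t}"
    using edge_line_eq(2)[OF ij m(1)] seg_param_eq[OF g] by simp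
  then show False
    using m(2) \<open>t < u\<close> curve_param_eq_iff[OF g(1)] by auto
qed

text \<open>\<open>first_exit_point\<close> allows the exit to be \<open>p j\<close> itself. The
  conditions that \<open>p j\<close> is no end of the edge \<open>m\<close> rule this out and give
  \<open>w > t\<close>.\<close>

lemma ray_exits_throughE:
  assumes ij: "i < n" "j < n" "i \<noteq> j"
    and g: "curve_param \<gamma> (line_of p \<L> i j)" "r < t" "\<gamma> r = p i" "\<gamma> t = p j"
    and ex: "ray_exits_through n p \<L> i j m" and m: "m < n" "j \<noteq> m" "j \<noteq> (m + 1) mod n"
  obtains w where "w > t" "\<gamma> w \<in> E m" "\<gamma> ` {t<..<w} \<subseteq> inside J"
proof -
  obtain x where x: "x \<in> E m" "first_exit_point (outside J) (line_of p \<L> i j) (\<gamma> r) (\<gamma> t) x"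
    using ex g(3,4) unfolding ray_exits_through_def by auto
  then obtain w where w: "w \<ge> t" "x = \<gamma> w" "\<gamma> ` {t..w} \<inter> outside J = {}"
    unfolding first_exit_point_param[OF g(1,2)] by blast
  have "w \<noteq> t" using w(2) x(1) g(4) vertex_mem_edge[OF ij(2) m(1)] m(2,3) by metis
  then have "t < w" using w(1) by simp
  moreover have "\<gamma> ` {t<..<w} \<subseteq> inside J"
  proof (rule subset_insideI[OF line_of_mem(1)[OF ij] g(1)])
    have "\<gamma> ` {t<..<w} \<subseteq> \<gamma> ` {t..w}" by auto
    then show "\<gamma> ` {t<..<w} \<inter> outside J = {}" using w(3) by blast
  qed (use ray_not_vertex[OF ij g] ray_edge_line[OF ij g] in blast)+
  ultimately show thesis using that w x by auto
qed

text \<open>Reaching an edge from the inside already is a first exit: \<open>\<gamma> w\<close> is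
  no vertex, so the ray crosses the edge there, and points arbitrarily close behind
  \<open>\<gamma> w\<close> are outside.\<close>

lemma ray_exits_throughI:
  assumes ij: "i < n" "j < n" "i \<noteq> j"
    and g: "curve_param \<gamma> (line_of p \<L> i j)" "r < t" "\<gamma> r = p i" "\<gamma> t = p j"
    and w: "w > t" "\<gamma> w \<in> E m" "\<gamma> ` {t<..<w} \<subseteq> inside J" and m: "m < n"
  shows "ray_exits_through n p \<L> i j m"
proof -
  have "\<gamma> v \<notin> outside J" if "t \<le> v" "v \<le> w" for v
  proof (cases "v = t \<or> v = w")
    case True
    moreover have "\<gamma> t \<in> J" unfolding g(4) by (rule vertex_mem_boundary[OF ij(2)])
    moreover have "\<gamma> w \<in> J" using w(2) edge_subset_boundary[OF m] by blast
    ultimately have "\<gamma> v \<in> J" by blast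
    then show ?thesis by (rule boundary_not_outside)
  next
    case False
    then have "\<gamma> v \<in> inside J" using w(3) that by auto
    then show ?thesis by (rule inside_not_outside)
  qed
  then have "\<gamma> ` {t..w} \<inter> outside J = {}" by auto
  moreover have "\<gamma> ` {w..v} \<inter> outside J \<noteq> {}" if "v > w" for v
  proof -
    obtain \<epsilon> where \<epsilon>: "\<epsilon> > 0"
      "\<And>c d. w - \<epsilon> < c \<Longrightarrow> c < w \<Longrightarrow> w < d \<Longrightarrow> d < w + \<epsilon> \<Longrightarrow>
         \<gamma> c \<notin> J \<and> \<gamma> d \<notin> J \<and> \<not> connected_component (- J) (\<gamma> c) (\<gamma> d)"
      using edge_crossing[OF line_of_mem(1)[OF ij] g(1) m ray_edge_line[OF ij g w(1) m w(2)] w(2)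
          ray_not_vertex[OF ij g w(1)]] by blast
    obtain c where c: "max t (w - \<epsilon>) < c" "c < w" using dense[of "max t (w - \<epsilon>)" w] \<epsilon>(1) w by auto
    obtain d where d: "w < d" "d < min v (w + \<epsilon>)" using dense[of w "min v (w + \<epsilon>)"] \<epsilon>(1) \<open>v > w\<close> by auto
    have cd: "\<gamma> d \<notin> J" "\<not> connected_component (- J) (\<gamma> c) (\<gamma> d)"
      using \<epsilon>(2)[of c d] c d by auto
    have "\<gamma> c \<in> inside J" using w(3) c by auto
    then have "\<gamma> d \<notin> inside J"
      using cd(2) jordan(2) inside_not_boundary connected_componentI[of "inside J" "- J" "\<gamma> c" "\<gamma> d"] by auto
    then have "\<gamma> d \<in> outside J" using cd(1) jordan(6) by blast
    moreover have "\<gamma> d \<in> \<gamma> ` {w..v}" using d by auto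
    ultimately show ?thesis by blast
  qed
  ultimately have "first_exit_point (outside J) (line_of p \<L> i j) (\<gamma> r) (\<gamma> t) (\<gamma> w)"
    unfolding first_exit_point_param[OF g(1,2)] using w(1) by (intro exI[of _ w]) auto
  then show ?thesis
    unfolding ray_exits_through_def using w(2) g(3,4) by auto
qed

text \<open>\<open>F\<close> is the rest of the edge \<open>m\<close> after \<open>z\<close>,
  followed by all later edges. Since \<open>z\<close> is not a vertex, even \<open>p m\<close> stays
  off \<open>F\<close>; this admits \<open>j = m\<close> for the exit edge.\<close>

lemma boundary_tail:
  assumes m: "m < n" and z: "z \<in> E m" "z \<notin> p ` {..<n}"
  obtains F where "compact F" "connected F" "z \<in> F" "p 0 \<in> F" "F \<subseteq> (\<Union>e\<in>{m..<n}. E e)"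
    "\<And>l. 0 < l \<Longrightarrow> l \<le> m \<Longrightarrow> p l \<notin> F"
proof -
  obtain \<eta> \<alpha> \<beta> where h: "curve_param \<eta> (line_of p \<L> m ((m + 1) mod n))" "\<alpha> < \<beta>" "\<eta> \<alpha> = p m"
    "\<eta> \<beta> = p ((m + 1) mod n)" "E m = \<eta> ` {\<alpha>..\<beta>}"
    using edge_param[OF m] .
  obtain \<xi> where xi: "z = \<eta> \<xi>" "\<alpha> \<le> \<xi>" "\<xi> \<le> \<beta>" using z(1) unfolding h(5) by auto
  have "z \<noteq> p m" using z(2) m by blast
  then have "\<xi> \<noteq> \<alpha>" using h(3) xi(1) by blast
  define F1 where "F1 = \<eta> ` {\<xi>..\<beta>}"
  have F1: "compact F1" "connected F1" "z \<in> F1" "p ((m + 1) mod n) \<in> F1" "F1 \<subseteq> E m" "p m \<notin> F1"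
    unfolding F1_def h(5) h(3,4)[symmetric] using xi \<open>\<xi> \<noteq> \<alpha>\<close> curve_param_eq_iff[OF h(1)]
    by (auto intro: compact_continuous_image connected_continuous_image curve_param_cont[OF h(1)])
  have F1': "p l \<notin> F1" if "0 < l" "l \<le> m" for l
    using F1(5,6) vertex_mem_edge[of l m] that m succ_mod[OF m] by (auto split: if_splits)
  \<comment> \<open>If \<open>m + 1 = n\<close>, the edge \<open>m\<close> ends at
    \<open>p 0\<close> and no further edges are attached.\<close>
  show thesis
  proof (cases "m + 1 = n")
    case True
    then show thesis using F1 F1' m by (intro that[of F1]) auto
  next
    case False
    obtain c where c: "arc c" "path_image c = (\<Union>e\<in>{m + 1..<n}. E e)" "pathstart c = p (m + 1)" "pathfinish c = p (n mod n)"
      using boundary_arc[of "m + 1" n] m False by auto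
    have c': "p 0 \<in> path_image c" "p (m + 1) \<in> path_image c"
      using c by (metis mod_self pathfinish_in_path_image pathstart_in_path_image)+
    show thesis
    proof (rule that[of "F1 \<union> path_image c"])
      show "connected (F1 \<union> path_image c)"
        using F1 c c' m False by (intro connected_Un connected_arc_image) auto
      show "compact (F1 \<union> path_image c)"
        using F1 c compact_arc_image by blast
      show "F1 \<union> path_image c \<subseteq> (\<Union>e\<in>{m..<n}. E e)"
      proof -
        have "m \<in> {m..<n}" "{m + 1..<n} \<subseteq> {m..<n}" using m by auto
        then show ?thesis unfolding c using F1(5) by blast
      qed
      show "p l \<notin> F1 \<union> path_image c" if "0 < l" "l \<le> m" for l
      proof -
        have "p l \<notin> E e" if "m + 1 \<le> e" "e < n" for e
          using vertex_mem_edge[of l e] succ_mod[of e] that m \<open>0 < l\<close> \<open>l \<le> m\<close> by (auto split: if_splits)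
        then show ?thesis using F1'[OF that] unfolding c by auto
      qed
    qed (use F1 c' in auto)
  qed
qed

end


section \<open>Cyclic intervals of indices\<close>

lemma bd_vertices_le: "a \<le> b \<Longrightarrow> b < n \<Longrightarrow> bd_vertices n a b = {a..b}"
proof -
  assume "a \<le> b" "b < n"
  then have "(n + b - a) mod n = b - a" by (simp add: mod_if)
  moreover have "(\<lambda>d. (a + d) mod n) ` {..b - a} = {a..b}"
  proof
    show "(\<lambda>d. (a + d) mod n) ` {..b - a} \<subseteq> {a..b}"
      using \<open>a \<le> b\<close> \<open>b < n\<close> by auto
    show "{a..b} \<subseteq> (\<lambda>d. (a + d) mod n) ` {..b - a}"
    proof
      fix c assume "c \<in> {a..b}"
      then show "c \<in> (\<lambda>d. (a + d) mod n) ` {..b - a}"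
        using \<open>b < n\<close> by (intro image_eqI[of _ _ "c - a"]) auto
    qed
  qed
  ultimately show ?thesis unfolding bd_vertices_def by simp
qed

lemma bd_edges_le: "a \<le> b \<Longrightarrow> b < n \<Longrightarrow> bd_edges n a b = {a..<b}"
proof -
  assume "a \<le> b" "b < n"
  then have "(n + b - a) mod n = b - a" by (simp add: mod_if)
  moreover have "(\<lambda>d. (a + d) mod n) ` {..<b - a} = {a..<b}"
  proof
    show "(\<lambda>d. (a + d) mod n) ` {..<b - a} \<subseteq> {a..<b}"
      using \<open>a \<le> b\<close> \<open>b < n\<close> by auto
    show "{a..<b} \<subseteq> (\<lambda>d. (a + d) mod n) ` {..<b - a}"
    proof
      fix c assume "c \<in> {a..<b}"
      then show "c \<in> (\<lambda>d. (a + d) mod n) ` {..<b - a}"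
        using \<open>b < n\<close> by (intro image_eqI[of _ _ "c - a"]) auto
    qed
  qed
  ultimately show ?thesis unfolding bd_edges_def by simp
qed

lemma bd_vertices_gt: "a < b \<Longrightarrow> b < n \<Longrightarrow> bd_vertices n b a = {b..<n} \<union> {..a}"
proof -
  assume "a < b" "b < n"
  then have "(n + a - b) mod n = n + a - b" by simp
  moreover have "(\<lambda>d. (b + d) mod n) ` {..n + a - b} = {b..<n} \<union> {..a}"
  proof
    show "(\<lambda>d. (b + d) mod n) ` {..n + a - b} \<subseteq> {b..<n} \<union> {..a}"
    proof
      fix c assume "c \<in> (\<lambda>d. (b + d) mod n) ` {..n + a - b}"
      then obtain d where d: "d \<le> n + a - b" "c = (b + d) mod n" by auto
      show "c \<in> {b..<n} \<union> {..a}"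
        using d \<open>a < b\<close> \<open>b < n\<close> by (cases "b + d < n") (auto simp: le_mod_geq)
    qed
    show "{b..<n} \<union> {..a} \<subseteq> (\<lambda>d. (b + d) mod n) ` {..n + a - b}"
    proof
      fix c assume c: "c \<in> {b..<n} \<union> {..a}"
      show "c \<in> (\<lambda>d. (b + d) mod n) ` {..n + a - b}"
      proof (cases "b \<le> c")
        case True
        then show ?thesis using c \<open>a < b\<close> by (intro image_eqI[of _ _ "c - b"]) auto
      next
        case False
        then show ?thesis using c \<open>a < b\<close> \<open>b < n\<close> by (intro image_eqI[of _ _ "n + c - b"]) auto
      qed
    qed
  qed
  ultimately show ?thesis unfolding bd_vertices_def by simp
qed

lemma bd_edges_gt: "a < b \<Longrightarrow> b < n \<Longrightarrow> bd_edges n b a = {b..<n} \<union> {..<a}"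
proof -
  assume "a < b" "b < n"
  then have "(n + a - b) mod n = n + a - b" by simp
  moreover have "(\<lambda>d. (b + d) mod n) ` {..<n + a - b} = {b..<n} \<union> {..<a}"
  proof
    show "(\<lambda>d. (b + d) mod n) ` {..<n + a - b} \<subseteq> {b..<n} \<union> {..<a}"
    proof
      fix c assume "c \<in> (\<lambda>d. (b + d) mod n) ` {..<n + a - b}"
      then obtain d where d: "d < n + a - b" "c = (b + d) mod n" by auto
      show "c \<in> {b..<n} \<union> {..<a}"
        using d \<open>a < b\<close> \<open>b < n\<close> by (cases "b + d < n") (auto simp: le_mod_geq)
    qed
    show "{b..<n} \<union> {..<a} \<subseteq> (\<lambda>d. (b + d) mod n) ` {..<n + a - b}"
    proof
      fix c assume c: "c \<in> {b..<n} \<union> {..<a}"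
      show "c \<in> (\<lambda>d. (b + d) mod n) ` {..<n + a - b}"
      proof (cases "b \<le> c")
        case True
        then show ?thesis using c \<open>a < b\<close> by (intro image_eqI[of _ _ "c - b"]) auto
      next
        case False
        then show ?thesis using c \<open>a < b\<close> \<open>b < n\<close> by (intro image_eqI[of _ _ "n + c - b"]) auto
      qed
    qed
  qed
  ultimately show ?thesis unfolding bd_edges_def by simp
qed


section \<open>The chord through a blocker\<close>

text \<open>
  The chord runs from \<open>p 0\<close> through the blocker \<open>p k\<close> to the exit point \<open>\<gamma> w\<close> on the edge \<open>m\<close>,
  and \<open>F\<close> is the part of the boundary from \<open>\<gamma> w\<close> to \<open>p 0\<close>.
\<close>

locale chord = edge_cycle +
  fixes k m :: nat and \<gamma> :: "real \<Rightarrow> complex" and r t w :: real and F :: "complex set"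
  assumes km: "1 < k" "k < m" "m < n"
    and g: "curve_param \<gamma> (line_of p \<L> 0 k)" "r < t" "\<gamma> r = p 0" "\<gamma> t = p k"
    and w: "t < w" "\<gamma> w \<in> E m"
    and near: "\<gamma> ` {r<..<t} \<subseteq> inside J" "\<gamma> ` {t<..<w} \<subseteq> inside J"
    and F: "compact F" "connected F" "\<gamma> w \<in> F" "p 0 \<in> F" "F \<subseteq> (\<Union>e\<in>{m..<n}. E e)"
      "\<And>l. 0 < l \<Longrightarrow> l \<le> m \<Longrightarrow> p l \<notin> F"
begin

definition K :: "complex set" where "K = \<gamma> ` {r..w} \<union> F"

lemma F_subset_boundary: "F \<subseteq> J"
  using F(5) unfolding poly_boundary_def by fastforce

lemma F_edge:
  assumes "z \<in> F" obtains e where "m \<le> e" "e < n" "z \<in> E e"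
proof -
  obtain e where "e \<in> {m..<n}" "z \<in> E e" using assms F(5) by blast
  then show thesis using that[of e] by simp
qed

lemma chord_inside:
  assumes "r < v" "v < w" "v \<noteq> t" shows "\<gamma> v \<in> inside J"
proof (cases "v < t")
  case True
  then have "\<gamma> v \<in> \<gamma> ` {r<..<t}" using assms by auto
  then show ?thesis using near by blast
next
  case False
  then have "\<gamma> v \<in> \<gamma> ` {t<..<w}" using assms by auto
  then show ?thesis using near by blast
qed

lemma K_cases:
  assumes "z \<in> K" shows "z \<in> F \<or> z = p k \<or> z \<in> inside J"
proof (cases "z \<in> F")
  case False
  then obtain v where v: "z = \<gamma> v" "r \<le> v" "v \<le> w" using assms unfolding K_def by auto
  have "v \<noteq> r" "v \<noteq> w" using False v(1) F(3,4) g(3) by auto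
  then show ?thesis using chord_inside[of v] v g(4) by auto
qed simp

lemma K_subset_line: "z \<in> K \<Longrightarrow> z \<in> line_of p \<L> 0 k \<or> z \<in> F"
  unfolding K_def using curve_param_mem[OF g(1)] by auto

lemma off_K_connected:
  assumes "u \<notin> K" "u \<notin> inside J" "v \<notin> K" "v \<notin> inside J"
  shows "connected_component (- K) u v"
proof -
  obtain c where c: "simple_path c" "pathfinish c = pathstart c" "path_image c = J"
    using boundary_loop .
  have "compact K"
    unfolding K_def using F(1) by (auto intro: compact_continuous_image curve_param_cont[OF g(1)])
  moreover have "K \<subseteq> J \<union> inside J"
    using K_cases F_subset_boundary vertex_mem_boundary[of k] km by fastforce
  ultimately show ?thesis
    using connected_component_off_subset[OF c(1,2) c(3)[symmetric]] assms compact_imp_closed by blast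
qed

lemma line_0k:
  shows "line_of p \<L> 0 k \<in> \<L>" "p 0 \<in> line_of p \<L> 0 k" "p k \<in> line_of p \<L> 0 k"
  using line_of_mem[of 0 k] km by auto

text \<open>Here the piece is the whole chord and \<open>F\<close> closes it up. The parameter
  \<open>t\<close> is included, so the crossing may be at \<open>p k\<close>, as needed for rays
  from \<open>p s\<close> through \<open>p k\<close>.\<close>

lemma crossing_K:
  assumes M: "M \<in> \<L>" "M \<noteq> line_of p \<L> 0 k" "curve_param \<delta> M"
    and u: "\<delta> u \<in> \<gamma> ` {r<..<w}" "\<delta> u \<notin> F"
  obtains \<epsilon> where "\<epsilon> > 0"
    "\<And>a b. u - \<epsilon> < a \<Longrightarrow> a < u \<Longrightarrow> u < b \<Longrightarrow> b < u + \<epsilon> \<Longrightarrow>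
       \<delta> a \<notin> K \<and> \<delta> b \<notin> K \<and> \<not> connected_component (- K) (\<delta> a) (\<delta> b)"
proof -
  have L: "\<delta> u \<in> line_of p \<L> 0 k" "\<delta> u \<in> M"
    using u(1) curve_param_mem[OF g(1)] curve_param_mem[OF M(3)] by auto
  note meet = lines_meet[OF line_0k(1) M(1) M(2)[symmetric] L]
  have "\<gamma> r \<in> F" using F(4) g(3) by simp
  show thesis
    by (rule crossing_separates_locally[OF meet(2,1) M(3) g(1) u(1) F(1,2) \<open>\<gamma> r \<in> F\<close> F(3) u(2), folded K_def])
       (rule that)
qed

lemma param_off_line:
  assumes M: "M \<in> \<L>" "M \<noteq> line_of p \<L> 0 k" "curve_param \<delta> M"
    and u: "\<delta> u \<in> line_of p \<L> 0 k" "v \<noteq> u"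
  shows "\<delta> v \<notin> line_of p \<L> 0 k"
  using lines_meet(1)[OF line_0k(1) M(1) M(2)[symmetric] u(1) curve_param_mem[OF M(3)]]
    curve_param_mem[OF M(3), of v] curve_param_eq_iff[OF M(3), of v u] u(2) by blast

text \<open>
  Such an arc has to meet the crosscut from \<open>p 0\<close> to \<open>p k\<close>; being there on a different
  pseudo-line, it changes sides with respect to \<open>K\<close>, although both of its ends are boundary points
  off \<open>K\<close> and it does not meet \<open>K\<close> again.
\<close>

lemma no_arc_across:
  assumes M: "M \<in> \<L>" "M \<noteq> line_of p \<L> 0 k" "curve_param \<delta> M"
    and ab: "a < b" "\<delta> ` {a<..<b} \<subseteq> inside J"
    and a: "\<delta> a \<in> (\<Union>e\<in>{0..<k}. E e)" "\<delta> a \<notin> F" "\<delta> a \<noteq> p k"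
    and b: "\<delta> b \<in> (\<Union>e\<in>{k..<n}. E e)" "\<delta> b \<notin> F" "\<delta> b \<noteq> p k"
  shows False
proof -
  have k: "0 < k" "k < n" using km by auto
  obtain c1 where c1: "arc c1" "path_image c1 = (\<Union>e\<in>{0..<k}. E e)" "pathstart c1 = p 0" "pathfinish c1 = p k"
    by (rule boundary_arc[of 0 k]) (use k in simp_all)
  obtain c2 where c2: "arc c2" "path_image c2 = (\<Union>e\<in>{k..<n}. E e)" "pathstart c2 = p k" "pathfinish c2 = p 0"
    by (rule boundary_arc[of k n]) (use k in simp_all)
  obtain c where c: "arc c" "path_image c = \<gamma> ` {r..t}" "pathstart c = p 0" "pathfinish c = p k"
    using curve_param_arc[OF g(1,2)] g(3,4) by metis
  have "\<delta> ` {a<..<b} \<inter> path_image c \<noteq> {}"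
  proof (rule crosscut_separates[where ?c1.0 = c1 and ?c2.0 = "reversepath c2" and a = "p 0" and b = "p k"
        and J = J and u = "\<delta> a" and v = "\<delta> b"])
    show "arc (reversepath c2)" "pathstart (reversepath c2) = p 0" "pathfinish (reversepath c2) = p k"
      using c2 by (auto simp: arc_reversepath)
    show "path_image c1 \<inter> path_image (reversepath c2) = {p 0, p k}"
      using boundary_arcs_meet[OF k] c1 c2 by simp
    show "J = path_image c1 \<union> path_image (reversepath c2)"
      using boundary_eq_Un[of k] k c1 c2 by simp
    show "path_image c - {p 0, p k} \<subseteq> inside J"
    proof
      fix z assume "z \<in> path_image c - {p 0, p k}"
      then have "z \<in> \<gamma> ` {r<..<t}"
        unfolding c(2) g(3,4)[symmetric] by (auto simp: le_less)
      then show "z \<in> inside J" using near(1) by blast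
    qed
    show "connected (\<delta> ` {a<..<b})"
      by (simp add: curve_param_connected_image[OF M(3)])
    have "\<delta> ` closure {a<..<b} \<subseteq> closure (\<delta> ` {a<..<b})"
      by (intro image_closure_subset curve_param_cont[OF M(3)]) (auto simp: closure_subset)
    then show "\<delta> a \<in> closure (\<delta> ` {a<..<b})" "\<delta> b \<in> closure (\<delta> ` {a<..<b})"
      using ab(1) by (auto simp: image_subset_iff)
    show "\<delta> a \<in> path_image c1 - {p 0, p k}" "\<delta> b \<in> path_image (reversepath c2) - {p 0, p k}"
      using a b F(4) c1(2) c2(2) by auto
  qed (use c1 c ab in auto)
  then obtain z where "z \<in> \<delta> ` {a<..<b}" "z \<in> \<gamma> ` {r..t}" unfolding c(2) by blast
  then obtain v where v: "a < v" "v < b" "\<delta> v \<in> \<gamma> ` {r..t}" by force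
  have inner: "\<delta> u \<in> inside J" if "a < u" "u < b" for u using ab(2) that by auto
  then have innerF: "\<delta> u \<notin> F" if "a < u" "u < b" for u
    using that inside_not_boundary F_subset_boundary by blast
  have "\<delta> v \<notin> J" using inner v(1,2) inside_not_boundary by blast
  then have "\<delta> v \<noteq> \<gamma> r" "\<delta> v \<noteq> \<gamma> t"
    using vertex_mem_boundary[of 0] vertex_mem_boundary[of k] k g(3,4) by auto
  then have vg: "\<delta> v \<in> \<gamma> ` {r<..<w}"
    using v(3) w(1) by (auto simp: le_less)
  then have vL: "\<delta> v \<in> line_of p \<L> 0 k"
    using curve_param_mem[OF g(1)] by auto
  obtain \<epsilon> where \<epsilon>: "\<epsilon> > 0"
    "\<And>c d. v - \<epsilon> < c \<Longrightarrow> c < v \<Longrightarrow> v < d \<Longrightarrow> d < v + \<epsilon> \<Longrightarrow>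
       \<delta> c \<notin> K \<and> \<delta> d \<notin> K \<and> \<not> connected_component (- K) (\<delta> c) (\<delta> d)"
    using crossing_K[OF M vg innerF[OF v(1,2)]] by blast
  obtain c where c: "max a (v - \<epsilon>) < c" "c < v" using dense[of "max a (v - \<epsilon>)" v] \<epsilon>(1) v by auto
  obtain d where d: "v < d" "d < min b (v + \<epsilon>)" using dense[of v "min b (v + \<epsilon>)"] \<epsilon>(1) v by auto
  \<comment> \<open>\<open>M\<close> has spent its only common point with the line of the chord at
    \<open>\<delta> v\<close>, and \<open>F\<close> is avoided by the inside and, by assumption, by
    both ends.\<close>
  have off: "\<delta> u \<notin> K" if "a \<le> u" "u \<le> b" "u \<noteq> v" for u
  proof -
    have "\<delta> u \<notin> F"
      using innerF[of u] that a(2) b(2) by (cases "u = a \<or> u = b") auto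
    then show ?thesis
      using K_subset_line param_off_line[OF M vL that(3)] by blast
  qed
  have "connected_component (- K) (\<delta> c) (\<delta> a)"
  proof (rule connected_componentI)
    show "connected (\<delta> ` {a..c})" by (simp add: curve_param_connected_image[OF M(3)])
    show "\<delta> ` {a..c} \<subseteq> - K" using off c d by auto
  qed (use c in auto)
  moreover have "connected_component (- K) (\<delta> b) (\<delta> d)"
  proof (rule connected_componentI)
    show "connected (\<delta> ` {d..b})" by (simp add: curve_param_connected_image[OF M(3)])
    show "\<delta> ` {d..b} \<subseteq> - K" using off c d by auto
  qed (use d in auto)
  moreover have "connected_component (- K) (\<delta> a) (\<delta> b)"
  proof (rule off_K_connected)
    have "\<delta> a \<in> J" "\<delta> b \<in> J" using a(1) b(1) boundary_eq_Un[of k] k by auto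
    then show "\<delta> a \<notin> inside J" "\<delta> b \<notin> inside J" using inside_not_boundary by blast+
    show "\<delta> a \<notin> K" "\<delta> b \<notin> K" using off v ab(1) by auto
  qed
  ultimately have "connected_component (- K) (\<delta> c) (\<delta> d)"
    using connected_component_trans by metis
  then show False using \<epsilon>(2)[of c d] c d by auto
qed

lemma line_neq:
  assumes "0 < s" "s < n" "s \<noteq> k" "l < n" "l \<noteq> s"
  shows "line_of p \<L> s l \<noteq> line_of p \<L> 0 k"
  using line_of_neq[of 0 k s l] assms km by auto

text \<open>The segment would be an arc forbidden by \<open>no_arc_across\<close>;
  \<open>l \<le> m\<close> keeps \<open>p l\<close> off \<open>F\<close>. Taking
  \<open>l = j\<close> gives the invisibility of \<open>(s, j)\<close>, other values restrict the
  position of blockers.\<close>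

lemma not_sees_across:
  assumes s: "0 < s" "s < k" and l: "k < l" "l \<le> m"
  shows "\<not> sees n p \<L> s l"
proof
  assume vis: "sees n p \<L> s l"
  have sl: "s < n" "l < n" "s \<noteq> l" "l \<noteq> (s + 1) mod n" "s \<noteq> (l + 1) mod n"
    using s l km succ_mod[of s] succ_mod[of l] by (auto split: if_splits)
  obtain \<delta> a b where d: "curve_param \<delta> (line_of p \<L> s l)" "a < b" "\<delta> a = p s" "\<delta> b = p l"
    using seg_param[OF sl(1-3)] by metis
  show False
  proof (rule no_arc_across[OF line_of_mem(1)[OF sl(1-3)] line_neq d(1,2) visible_interior[OF sl vis d]])
    show "\<delta> a \<in> (\<Union>e\<in>{0..<k}. E e)" "\<delta> b \<in> (\<Union>e\<in>{k..<n}. E e)"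
      unfolding d(3,4) using vertex_mem_edge sl s l by auto
    show "\<delta> a \<notin> F" "\<delta> b \<notin> F"
      unfolding d(3,4) using F(6) s l km by auto
    show "\<delta> a \<noteq> p k" "\<delta> b \<noteq> p k"
      unfolding d(3,4) using vertex_eq_iff sl s l km by auto
  qed (use sl s in auto)
qed

text \<open>
  Seen from \<open>p s\<close>, the line crosses the chord at \<open>p k\<close>, hence continues inside the polygon in the
  part cut off by \<open>K\<close>. Since it cannot meet the chord again, it has to leave through \<open>F\<close>.
\<close>

lemma ray_exits_through_tail:
  assumes s: "0 < s" "s < k" and vis: "sees n p \<L> s k"
  obtains e where "m \<le> e" "e < n" "ray_exits_through n p \<L> s k e"
proof -
  have sk: "s < n" "k < n" "s \<noteq> k" using s km by auto
  obtain \<delta> a b where d: "curve_param \<delta> (line_of p \<L> s k)" "a < b" "\<delta> a = p s" "\<delta> b = p k"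
      "seg p \<L> s k = \<delta> ` {a..b}"
    using seg_param[OF sk] .
  note M = line_of_mem(1)[OF sk] line_neq[OF s(1) sk(1) sk(3) sk(2) sk(3)[symmetric]] d(1)
  have bL: "\<delta> b \<in> line_of p \<L> 0 k" unfolding d(4) by (rule line_0k(3))
  have offL: "\<delta> u \<notin> line_of p \<L> 0 k" if "u \<noteq> b" for u
    using param_off_line[OF M bL that] .
  have offF: "\<delta> u \<notin> F" if u: "a \<le> u" "u \<le> b" for u
  proof (cases "k = s + 1")
    \<comment> \<open>The segment is now an edge and not inside the polygon. The edges from
      \<open>m\<close> to \<open>n - 1\<close> are not adjacent to it because \<open>0 < s\<close>
      and \<open>s + 1 = k < m\<close>.\<close>
    case True
    then have "\<delta> u \<in> E s" using d(5) sk u unfolding edge_def by simp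
    moreover have "E s \<inter> E e = {}" if "e \<in> {m..<n}" for e
      using disjoint[of s e] succ_mod[of e] that s km True by (auto split: if_splits)
    ultimately show ?thesis using F(5) by blast
  next
    case False
    then have "k \<noteq> (s + 1) mod n" "s \<noteq> (k + 1) mod n"
      using s km succ_mod[of s] succ_mod[of k] by (auto split: if_splits)
    then have inner: "\<delta> ` {a<..<b} \<subseteq> inside J"
      using visible_interior[OF sk _ _ vis d(1-4)] by blast
    show ?thesis
    proof (cases "u = a \<or> u = b")
      case True
      then show ?thesis using d(3,4) F(6)[of s] F(6)[of k] s km by auto
    next
      case False
      then have "\<delta> u \<in> inside J" using inner u by auto
      then show ?thesis using inside_not_boundary F_subset_boundary by blast
    qed
  qed
  have "\<gamma> t \<in> \<gamma> ` {r<..<w}" using g(2) w(1) by (intro imageI) simp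
  then have "\<delta> b \<in> \<gamma> ` {r<..<w}" using d(4) g(4) by metis
  then obtain \<epsilon> where \<epsilon>: "\<epsilon> > 0"
    "\<And>c f. b - \<epsilon> < c \<Longrightarrow> c < b \<Longrightarrow> b < f \<Longrightarrow> f < b + \<epsilon> \<Longrightarrow>
       \<delta> c \<notin> K \<and> \<delta> f \<notin> K \<and> \<not> connected_component (- K) (\<delta> c) (\<delta> f)"
    using crossing_K[OF M _ offF[of b]] d(2) by auto
  obtain c where c: "max a (b - \<epsilon>) < c" "c < b" using dense[of "max a (b - \<epsilon>)" b] \<epsilon>(1) d(2) by auto
  have sK: "p s \<notin> K"
    using K_subset_line[of "\<delta> a"] offL[of a] offF[of a] d(2,3) by auto
  have sJ: "p s \<notin> inside J"
    using vertex_mem_boundary[OF sk(1)] inside_not_boundary by blast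
  have ca: "connected_component (- K) (\<delta> c) (p s)"
    unfolding d(3)[symmetric]
  proof (rule connected_componentI)
    show "connected (\<delta> ` {a..c})" by (simp add: curve_param_connected_image[OF d(1)])
    show "\<delta> ` {a..c} \<subseteq> - K" using K_subset_line offL offF c by fastforce
  qed (use c in auto)
  \<comment> \<open>Just behind \<open>p k\<close> the line is on the other side of \<open>K\<close>
    than \<open>p s\<close>. A point off \<open>K\<close> that is not inside would be on the side of
    \<open>p s\<close>, by \<open>off_K_connected\<close>.\<close>
  have after: "\<delta> f \<in> inside J" "\<delta> f \<notin> K" "\<not> connected_component (- K) (\<delta> f) (p s)"
    if f: "b < f" "f < b + \<epsilon>" for f
  proof -
    have cf: "\<delta> f \<notin> K" "\<not> connected_component (- K) (\<delta> c) (\<delta> f)"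
      using \<epsilon>(2)[of c f] c f by auto
    then show fK: "\<delta> f \<notin> K" "\<not> connected_component (- K) (\<delta> f) (p s)"
      using ca connected_component_trans connected_component_sym by metis+
    then show "\<delta> f \<in> inside J"
      using off_K_connected[OF fK(1) _ sK sJ] by blast
  qed
  define f where "f = b + \<epsilon> / 2"
  have f: "b < f" "f < b + \<epsilon>" unfolding f_def using \<epsilon>(1) by auto
  \<comment> \<open>The least element of \<open>Y\<close> is the exit parameter. The search starts
    at \<open>f\<close> and not at \<open>b\<close>, because \<open>\<delta> b\<close> is a vertex
    and itself not inside; \<open>Y\<close> is nonempty since the inside is bounded and the curve is
    proper.\<close>
  define Y where "Y = {v. f \<le> v \<and> \<delta> v \<notin> inside J}"
  obtain R where R: "\<And>z. z \<in> inside J \<Longrightarrow> norm z \<le> R"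
    using jordan(3) bounded_iff by metis
  obtain T where T: "\<And>v. norm (\<delta> v) \<le> R \<Longrightarrow> \<bar>v\<bar> \<le> T"
    using curve_param_proper[OF d(1)] by metis
  have "\<delta> (max f (\<bar>T\<bar> + 1)) \<notin> inside J"
  proof
    assume "\<delta> (max f (\<bar>T\<bar> + 1)) \<in> inside J"
    from T[OF R[OF this]] show False by (simp add: abs_if split: if_splits)
  qed
  then have "Y \<noteq> {}" unfolding Y_def by (metis (mono_tags, lifting) empty_iff max.cobounded1 mem_Collect_eq)
  have bdd: "bdd_below Y" unfolding Y_def by (intro bdd_belowI[of _ f]) auto
  have "closed (\<delta> -` (- inside J))"
    using jordan(1) curve_param_cont[OF d(1), of UNIV]
    by (intro continuous_closed_vimage) (auto simp: continuous_on_eq_continuous_at)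
  moreover have "Y = {f..} \<inter> \<delta> -` (- inside J)" unfolding Y_def by auto
  ultimately have "closed Y" by auto
  define y where "y = Inf Y"
  have "y \<in> Y" unfolding y_def using closed_contains_Inf[OF \<open>Y \<noteq> {}\<close> bdd \<open>closed Y\<close>] .
  then have y: "f \<le> y" "\<delta> y \<notin> inside J" unfolding Y_def by auto
  have "\<delta> v \<in> inside J" if "f \<le> v" "v < y" for v
  proof (rule ccontr)
    assume "\<delta> v \<notin> inside J"
    then have "v \<in> Y" unfolding Y_def using that by simp
    then show False using cInf_lower[OF _ bdd] that unfolding y_def by force
  qed
  then have inner: "\<delta> v \<in> inside J" if "b < v" "v < y" for v
    using that after(1)[of v] f by (cases "f \<le> v") auto
  have ygt: "b < y" using f y by simp
  have "\<delta> y \<in> J"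
  proof -
    have "\<delta> ` closure {b<..<y} \<subseteq> closure (inside J)"
      using inner closure_subset[of "inside J"]
      by (intro image_closure_subset curve_param_cont[OF d(1)]) (auto simp: subset_iff)
    then have "\<delta> y \<in> closure (inside J)" using ygt by auto
    then show ?thesis using y(2) jordan(1,4) by (auto simp: frontier_def interior_open)
  qed
  \<comment> \<open>Otherwise the path from \<open>\<delta> f\<close> to \<open>\<delta> y\<close>
    avoids \<open>K\<close> and ends at a boundary point off \<open>K\<close>, which is on the side
    of \<open>p s\<close>, contrary to \<open>after\<close>.\<close>
  have "\<delta> y \<in> F"
  proof (rule ccontr)
    assume "\<delta> y \<notin> F"
    then have off: "\<delta> v \<notin> K" if "f \<le> v" "v \<le> y" for v
    proof (cases "v = y")
      case True
      then show ?thesis using \<open>\<delta> y \<notin> F\<close> K_subset_line[of "\<delta> y"] offL[of y] ygt by auto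
    next
      case False
      then have "\<delta> v \<notin> F" using inner[of v] that f inside_not_boundary F_subset_boundary by fastforce
      then show ?thesis using K_subset_line[of "\<delta> v"] offL[of v] that f by auto
    qed
    have "connected_component (- K) (\<delta> f) (\<delta> y)"
    proof (rule connected_componentI)
      show "connected (\<delta> ` {f..y})" by (simp add: curve_param_connected_image[OF d(1)])
      show "\<delta> ` {f..y} \<subseteq> - K" using off by auto
    qed (use y(1) in auto)
    moreover have "connected_component (- K) (\<delta> y) (p s)"
      using off_K_connected[OF off[OF y(1) order_refl] y(2) sK sJ] .
    ultimately show False
      using after(3)[OF f] connected_component_trans by metis
  qed
  then obtain e where e: "m \<le> e" "e < n" "\<delta> y \<in> E e" by (rule F_edge)
  have "\<delta> ` {b<..<y} \<subseteq> inside J" using inner by auto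
  then show thesis
    using that[OF e(1,2)] ray_exits_throughI[OF sk d(1-4) ygt e(3) _ e(2)] by blast
qed

end

section \<open>Transfer of blockers for \<open>0 < s < k < j\<close>\<close>

context edge_cycle
begin

text \<open>\<open>1 < k\<close> makes \<open>p 0\<close> and \<open>p k\<close> non-adjacent, so
  the first part of the chord is inside; \<open>k < j \<le> m\<close> keeps \<open>p k\<close> off
  the exit edge, so the ray really continues past it.\<close>

lemma chord_exists:
  assumes db: "designated_blocker n p \<L> 0 j k" and k: "1 < k" "k < j"
  obtains m \<gamma> r t w F where "j \<le> m" "chord n p \<L> k m \<gamma> r t w F"
proof -
  have j: "j < n" and vis: "sees n p \<L> 0 k"
    using db unfolding designated_blocker_def invisible_pair_def by auto
  have "bd_vertices n j 0 = {j..<n} \<union> {..0}" "bd_edges n j 0 = {j..<n} \<union> {..<0}"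
    using bd_vertices_gt[of 0 j n] bd_edges_gt[of 0 j n] k j by auto
  then obtain m where m: "j \<le> m" "m < n" and ex: "ray_exits_through n p \<L> 0 k m"
    using db k unfolding designated_blocker_def by auto
  have ij: "0 < n" "k < n" "0 \<noteq> k" "k \<noteq> (0 + 1) mod n" "0 \<noteq> (k + 1) mod n"
    using k m by auto
  obtain \<gamma> r t where g: "curve_param \<gamma> (line_of p \<L> 0 k)" "r < t" "\<gamma> r = p 0" "\<gamma> t = p k"
    using seg_param[OF ij(1-3)] by metis
  have "k \<noteq> m" "k \<noteq> (m + 1) mod n" using k m succ_mod[of m] by (auto split: if_splits)
  then obtain w where w: "w > t" "\<gamma> w \<in> E m" "\<gamma> ` {t<..<w} \<subseteq> inside J"
    using ray_exits_throughE[OF ij(1-3) g ex m(2)] by metis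
  obtain F where F: "compact F" "connected F" "\<gamma> w \<in> F" "p 0 \<in> F" "F \<subseteq> (\<Union>e\<in>{m..<n}. E e)"
      "\<And>l. 0 < l \<Longrightarrow> l \<le> m \<Longrightarrow> p l \<notin> F"
    using boundary_tail[OF m(2) w(2) ray_not_vertex[OF ij(1-3) g w(1)]] by metis
  have "chord n p \<L> k m \<gamma> r t w F"
    using k m g w F visible_interior[OF ij vis g]
    by (intro chord.intro edge_cycle_axioms chord_axioms.intro) auto
  then show thesis using that m(1) by blast
qed

text \<open>For the first claim, an exit edge from \<open>m \<ge> j\<close> on lies on the required
  side of \<open>(s, j)\<close>. For the second, two things could go wrong when \<open>k\<close> is
  replaced by \<open>j\<close>: the exit edge could lie between \<open>k\<close> and
  \<open>j\<close>, which \<open>no_arc_across\<close> forbids for the ray behind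
  \<open>p l\<close>, or \<open>l\<close> itself could, which \<open>not_sees_across\<close> forbids
  since \<open>p s\<close> sees \<open>p l\<close>.\<close>

lemma blocker_transfer:
  assumes db: "designated_blocker n p \<L> 0 j k" and k: "k < j" and s: "0 < s" "s < k"
  shows "sees n p \<L> s k \<Longrightarrow> designated_blocker n p \<L> s j k"
    and "designated_blocker n p \<L> s k l \<Longrightarrow> designated_blocker n p \<L> s j l"
proof -
  have j: "j < n" using db unfolding designated_blocker_def invisible_pair_def by auto
  have "1 < k" using s by simp
  then obtain m \<gamma> r t w F where m: "j \<le> m" and ch: "chord n p \<L> k m \<gamma> r t w F"
    by (rule chord_exists[OF db _ k])
  interpret chord n p \<L> k m \<gamma> r t w F by (rule ch)
  have inv: "invisible_pair n p \<L> s j"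
    unfolding invisible_pair_def using not_sees_across[OF s k m] s k j by auto
  have bd: "bd_vertices n s j = {s..j}" "bd_vertices n j s = {j..<n} \<union> {..s}"
      "bd_edges n s j = {s..<j}" "bd_edges n j s = {j..<n} \<union> {..<s}"
      "bd_vertices n s k = {s..k}" "bd_vertices n k s = {k..<n} \<union> {..s}"
      "bd_edges n s k = {s..<k}" "bd_edges n k s = {k..<n} \<union> {..<s}"
    using bd_vertices_le[of s j n] bd_vertices_gt[of s j n] bd_edges_le[of s j n] bd_edges_gt[of s j n]
      bd_vertices_le[of s k n] bd_vertices_gt[of s k n] bd_edges_le[of s k n] bd_edges_gt[of s k n]
      s k j by auto
  show "designated_blocker n p \<L> s j k" if vis: "sees n p \<L> s k"
  proof -
    obtain e where "m \<le> e" "e < n" "ray_exits_through n p \<L> s k e"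
      using ray_exits_through_tail[OF s vis] .
    then show ?thesis
      unfolding designated_blocker_def bd using inv vis s k j m by auto
  qed
  show "designated_blocker n p \<L> s j l" if dbl: "designated_blocker n p \<L> s k l"
  proof -
    have l: "l < n" "l \<noteq> s" "l \<noteq> k" and vis: "sees n p \<L> s l"
      using dbl unfolding designated_blocker_def by auto
    have sn: "s < n" using s k j by simp
    consider e where "s < l" "l < k" "ray_exits_through n p \<L> s l e" "e \<in> {k..<n} \<union> {..<s}"
      | e where "k < l \<or> l < s" "ray_exits_through n p \<L> s l e" "e \<in> {s..<k}"
      using dbl l unfolding designated_blocker_def bd by fastforce
    then show ?thesis
    proof cases
      case (1 e)
      have "e \<in> {j..<n} \<union> {..<s}"
      proof (rule ccontr)
        assume "e \<notin> {j..<n} \<union> {..<s}"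
        then have e: "k \<le> e" "e < j" "e < n" using 1(4) j by auto
        have le: "l \<noteq> e" "l \<noteq> (e + 1) mod n" using 1(2) e j succ_mod[of e] by auto
        obtain \<delta> a b where d: "curve_param \<delta> (line_of p \<L> s l)" "a < b" "\<delta> a = p s" "\<delta> b = p l"
          using seg_param[OF sn l(1) l(2)[symmetric]] by metis
        obtain y where y: "y > b" "\<delta> y \<in> E e" "\<delta> ` {b<..<y} \<subseteq> inside J"
          using ray_exits_throughE[OF sn l(1) l(2)[symmetric] d 1(3) e(3) le] .
        have yv: "\<delta> y \<notin> p ` {..<n}" by (rule ray_not_vertex[OF sn l(1) l(2)[symmetric] d y(1)])
        show False
        proof (rule no_arc_across[OF line_of_mem(1)[OF sn l(1) l(2)[symmetric]] line_neq d(1) y(1,3)])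
          show "\<delta> b \<in> (\<Union>e\<in>{0..<k}. E e)" "\<delta> y \<in> (\<Union>e\<in>{k..<n}. E e)"
            unfolding d(4) using vertex_mem_edge[of l l] 1(2) l(1) y(2) e by auto
          show "\<delta> b \<notin> F" unfolding d(4) using F(6)[of l] 1 k m by auto
          \<comment> \<open>\<open>F\<close> lies on edges from \<open>m\<close> on, whereas
            \<open>e < j \<le> m\<close>; a common point would be a vertex, which
            \<open>\<delta> y\<close> is not.\<close>
          show "\<delta> y \<notin> F"
          proof
            assume "\<delta> y \<in> F"
            then obtain e' where "m \<le> e'" "e' < n" "\<delta> y \<in> E e'" by (rule F_edge)
            then show False using edges_meet[of e e' "\<delta> y"] y(2) e m yv by auto
          qed
          show "\<delta> b \<noteq> p k" unfolding d(4) using vertex_eq_iff l k j by auto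
          show "\<delta> y \<noteq> p k" using yv k j by auto
        qed (use s sn l in auto)
      qed
      then show ?thesis
        unfolding designated_blocker_def bd using inv vis l 1 k by auto
    next
      case (2 e)
      \<comment> \<open>The bound includes \<open>l = j\<close>, so this also yields
        \<open>l \<noteq> j\<close>, which a blocker for \<open>(s, j)\<close> must satisfy.\<close>
      have "\<not> (k < l \<and> l \<le> j)" using not_sees_across[OF s, of l] vis m by auto
      then have "j < l \<or> l < s" using 2(1) by auto
      then show ?thesis
        unfolding designated_blocker_def bd using inv vis l 2 k s by auto
    qed
  qed
qed

end


section \<open>Rotating and reflecting the boundary\<close>

lemma int_cyclic_distance:
  "i < n \<Longrightarrow> int ((n + j - i) mod n) = (int j - int i) mod int n"
  using mod_add_self2[of "int j - int i" "int n"] by (simp add: zmod_int of_nat_diff algebra_simps)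

lemma cyclic_shift_image:
  assumes "i < n" "A \<subseteq> {..<n}"
  shows "x \<in> (\<lambda>d. (i + d) mod n) ` A \<longleftrightarrow> x < n \<and> nat ((int x - int i) mod int n) \<in> A"
proof
  assume "x \<in> (\<lambda>d. (i + d) mod n) ` A"
  then obtain d where d: "d \<in> A" "x = (i + d) mod n" by auto
  then have "d < n" using assms by auto
  moreover have "(int x - int i) mod int n = int d mod int n"
    unfolding d(2) by (simp add: zmod_int mod_simps)
  ultimately have "(int x - int i) mod int n = int d" by simp
  then show "x < n \<and> nat ((int x - int i) mod int n) \<in> A" using d assms by simp
next
  assume x: "x < n \<and> nat ((int x - int i) mod int n) \<in> A"
  define d where "d = nat ((int x - int i) mod int n)"
  have "int d = (int x - int i) mod int n" unfolding d_def using assms by simp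
  then have "int ((i + d) mod n) = int x" using x by (simp add: zmod_int mod_simps)
  then show "x \<in> (\<lambda>d. (i + d) mod n) ` A" using x unfolding d_def by (metis image_eqI of_nat_eq_iff)
qed

text \<open>Cyclic distances from \<open>i\<close>, taken in the integers, do not change under
  rotation and turn into complementary distances under reflection; so relabelling becomes arithmetic
  modulo \<open>n\<close>.\<close>

lemma mem_bd_vertices:
  assumes "i < n" "j < n"
  shows "x \<in> bd_vertices n i j \<longleftrightarrow> x < n \<and> (int x - int i) mod int n \<le> (int j - int i) mod int n"
proof -
  have "{..(n + j - i) mod n} \<subseteq> {..<n}" using assms by (auto intro: le_less_trans)
  from cyclic_shift_image[OF assms(1) this] show ?thesis
    unfolding bd_vertices_def using int_cyclic_distance[OF assms(1), of j] assms by (auto simp: nat_le_iff)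
qed

lemma mem_bd_edges:
  assumes "i < n" "j < n"
  shows "x \<in> bd_edges n i j \<longleftrightarrow> x < n \<and> (int x - int i) mod int n < (int j - int i) mod int n"
proof -
  have "{..<(n + j - i) mod n} \<subseteq> {..<n}" using assms by (auto intro: less_trans)
  from cyclic_shift_image[OF assms(1) this] show ?thesis
    unfolding bd_edges_def using int_cyclic_distance[OF assms(1), of j] assms by (auto simp: nat_less_iff)
qed

lemma complement_mod_le_iff:
  fixes e D N :: int
  assumes "0 \<le> e" "e < N" "0 \<le> D" "D < N"
  shows "(D - e) mod N \<le> D \<longleftrightarrow> e \<le> D" "(D - 1 - e) mod N < D \<longleftrightarrow> e < D"
proof -
  show "(D - e) mod N \<le> D \<longleftrightarrow> e \<le> D"
  proof (cases "e \<le> D")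
    case False
    then have "(D - e) mod N = D - e + N"
      using assms mod_add_self2[of "D - e" N] mod_pos_pos_trivial[of "D - e + N" N] by simp
    then show ?thesis using False assms by simp
  qed (use assms in simp)
  show "(D - 1 - e) mod N < D \<longleftrightarrow> e < D"
  proof (cases "e < D")
    case False
    then have "(D - 1 - e) mod N = D - 1 - e + N"
      using assms mod_add_self2[of "D - 1 - e" N] mod_pos_pos_trivial[of "D - 1 - e + N" N] by simp
    then show ?thesis using False assms by simp
  qed (use assms in simp)
qed

text \<open>With \<open>flip\<close> the boundary is traversed clockwise, so that an edge gets named after its other endpoint.\<close>

definition relabel :: "bool \<Rightarrow> nat \<Rightarrow> nat \<Rightarrow> nat \<Rightarrow> nat" where
  "relabel flip c n i = (if flip then c + n - i else c + i) mod n"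

definition edge_relabel :: "bool \<Rightarrow> nat \<Rightarrow> nat \<Rightarrow> nat \<Rightarrow> nat" where
  "edge_relabel flip c n i = relabel flip c n (if flip then (i + 1) mod n else i)"

lemma int_relabel:
  "i < n \<Longrightarrow> int (relabel flip c n i) = (if flip then int c - int i else int c + int i) mod int n"
  unfolding relabel_def using mod_add_self2[of "int c - int i" "int n"]
  by (simp add: zmod_int of_nat_diff algebra_simps)

lemma int_edge_relabel:
  "i < n \<Longrightarrow> int (edge_relabel flip c n i) = (if flip then int c - 1 - int i else int c + int i) mod int n"
  unfolding edge_relabel_def by (simp add: int_relabel) (simp add: zmod_int mod_simps algebra_simps)

lemma relabel_less: "i < n \<Longrightarrow> relabel flip c n i < n"
  unfolding relabel_def by simp

lemma edge_relabel_less: "i < n \<Longrightarrow> edge_relabel flip c n i < n"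
  unfolding edge_relabel_def relabel_def by simp

lemma relabel_inj: "inj_on (relabel flip c n) {..<n}"
proof (rule inj_onI)
  fix i j assume ij: "i \<in> {..<n}" "j \<in> {..<n}" "relabel flip c n i = relabel flip c n j"
  then have "int (relabel flip c n i) = int (relabel flip c n j)" by simp
  then have "int n dvd int i - int j"
    using ij int_relabel[of i n flip c] int_relabel[of j n flip c]
    by (auto simp: mod_eq_dvd_iff algebra_simps dvd_diff_commute split: if_splits)
  then have "int i mod int n = int j mod int n" by (simp add: mod_eq_dvd_iff)
  then show "i = j" using ij by simp
qed

lemma relabel_surj: "relabel flip c n ` {..<n} = {..<n}"
  using relabel_inj relabel_less by (intro endo_inj_surj) auto

lemma edge_relabel_inj: "inj_on (edge_relabel flip c n) {..<n}"
proof (rule inj_onI)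
  fix i j assume ij: "i \<in> {..<n}" "j \<in> {..<n}" "edge_relabel flip c n i = edge_relabel flip c n j"
  then have "int (edge_relabel flip c n i) = int (edge_relabel flip c n j)" by simp
  then have "int n dvd int i - int j"
    using ij int_edge_relabel[of i n flip c] int_edge_relabel[of j n flip c]
    by (auto simp: mod_eq_dvd_iff algebra_simps dvd_diff_commute split: if_splits)
  then have "int i mod int n = int j mod int n" by (simp add: mod_eq_dvd_iff)
  then show "i = j" using ij by simp
qed

lemma edge_relabel_surj: "edge_relabel flip c n ` {..<n} = {..<n}"
  using edge_relabel_inj edge_relabel_less by (intro endo_inj_surj) auto

lemma relabel_bd_vertices:
  assumes "a < n" "b < n" "x < n"
  shows "relabel flip c n x \<in> bd_vertices n (relabel flip c n a) (relabel flip c n b)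
    \<longleftrightarrow> x \<in> (if flip then bd_vertices n b a else bd_vertices n a b)"
proof (cases flip)
  case True
  define D where "D = (int a - int b) mod int n"
  define e where "e = (int a - int x) mod int n"
  have "(int x - int b) mod int n = (D - e) mod int n"
    unfolding D_def e_def by (simp add: mod_simps)
  moreover have "0 \<le> e" "e < int n" "0 \<le> D" "D < int n"
    unfolding D_def e_def using assms by auto
  ultimately show ?thesis
    using complement_mod_le_iff(1)[of e "int n" D] assms True unfolding D_def e_def
    by (simp add: mem_bd_vertices relabel_less int_relabel mod_simps)
next
  case False
  then show ?thesis
    using assms by (simp add: mem_bd_vertices relabel_less int_relabel mod_simps)
qed

lemma edge_relabel_bd_edges:
  assumes "a < n" "b < n" "x < n"
  shows "edge_relabel flip c n x \<in> bd_edges n (relabel flip c n a) (relabel flip c n b)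
    \<longleftrightarrow> x \<in> (if flip then bd_edges n b a else bd_edges n a b)"
proof (cases flip)
  case True
  define D where "D = (int a - int b) mod int n"
  define e where "e = (int a - 1 - int x) mod int n"
  have "(int x - int b) mod int n = (D - 1 - e) mod int n"
    unfolding D_def e_def by (simp add: mod_simps)
  moreover have "0 \<le> e" "e < int n" "0 \<le> D" "D < int n"
    unfolding D_def e_def using assms by auto
  moreover have "(int c - 1 - int x - (int c - int a)) mod int n = e"
    unfolding e_def by (simp add: algebra_simps)
  ultimately show ?thesis
    using complement_mod_le_iff(2)[of e "int n" D] assms True unfolding D_def
    by (simp add: mem_bd_edges relabel_less edge_relabel_less int_relabel int_edge_relabel mod_simps)
next
  case False
  then show ?thesis
    using assms by (simp add: mem_bd_edges relabel_less edge_relabel_less int_relabel int_edge_relabel mod_simps)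
qed

lemma relabel_succ:
  assumes "i < n"
  shows "relabel False c n ((i + 1) mod n) = (relabel False c n i + 1) mod n"
    and "relabel True c n i = (relabel True c n ((i + 1) mod n) + 1) mod n"
proof -
  have "int (relabel False c n ((i + 1) mod n)) = int ((relabel False c n i + 1) mod n)"
    "int (relabel True c n i) = int ((relabel True c n ((i + 1) mod n) + 1) mod n)"
    using assms by (simp_all add: int_relabel zmod_int mod_simps algebra_simps)
  then show "relabel False c n ((i + 1) mod n) = (relabel False c n i + 1) mod n"
    "relabel True c n i = (relabel True c n ((i + 1) mod n) + 1) mod n"
    by linarith+
qed

lemma line_of_relabel: "line_of (p \<circ> v) \<L> a b = line_of p \<L> (v a) (v b)"
  unfolding line_of_def by simp

lemma seg_relabel: "seg (p \<circ> v) \<L> a b = seg p \<L> (v a) (v b)"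
  unfolding seg_def by (simp add: line_of_relabel)

section \<open>Invariance of cycles and blockers under relabelling\<close>

context edge_cycle
begin

lemma edge_relabel:
  assumes "i < n"
  shows "edge n (p \<circ> relabel flip c n) \<L> i = E (edge_relabel flip c n i)"
proof (cases flip)
  case True
  have "(relabel True c n ((i + 1) mod n) + 1) mod n = relabel True c n i"
    using relabel_succ(2)[OF assms] by simp
  then show ?thesis
    using True seg_commute unfolding edge_def seg_relabel edge_relabel_def by simp
next
  case False
  have "(relabel False c n i + 1) mod n = relabel False c n ((i + 1) mod n)"
    using relabel_succ(1)[OF assms] by simp
  then show ?thesis
    using False unfolding edge_def seg_relabel edge_relabel_def by simp
qed

lemma poly_boundary_relabel: "poly_boundary n (p \<circ> relabel flip c n) \<L> = J"
proof -
  have "poly_boundary n (p \<circ> relabel flip c n) \<L> = (\<Union>i<n. E (edge_relabel flip c n i))"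
    unfolding poly_boundary_def using edge_relabel by simp
  also have "\<dots> = (\<Union>i\<in>edge_relabel flip c n ` {..<n}. E i)" by simp
  finally show ?thesis unfolding edge_relabel_surj poly_boundary_def .
qed

lemma sees_relabel: "sees n (p \<circ> relabel flip c n) \<L> a b = sees n p \<L> (relabel flip c n a) (relabel flip c n b)"
  unfolding sees_def poly_boundary_relabel seg_relabel ..

lemma relabel_eq_iff: "a < n \<Longrightarrow> b < n \<Longrightarrow> relabel flip c n a = relabel flip c n b \<longleftrightarrow> a = b"
  using inj_on_eq_iff[OF relabel_inj] by auto

lemma ray_exits_through_relabel:
  "x < n \<Longrightarrow> ray_exits_through n (p \<circ> relabel flip c n) \<L> a b x =
    ray_exits_through n p \<L> (relabel flip c n a) (relabel flip c n b) (edge_relabel flip c n x)"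
  unfolding ray_exits_through_def poly_boundary_relabel line_of_relabel by (simp add: edge_relabel)

lemma bd_edges_ray_exits_relabel:
  assumes "a < n" "b < n"
  shows "(\<exists>x \<in> (if flip then bd_edges n b a else bd_edges n a b).
      ray_exits_through n (p \<circ> relabel flip c n) \<L> l k x) \<longleftrightarrow>
    (\<exists>x \<in> bd_edges n (relabel flip c n a) (relabel flip c n b).
      ray_exits_through n p \<L> (relabel flip c n l) (relabel flip c n k) x)" (is "?A \<longleftrightarrow> ?B")
proof
  assume ?A
  then obtain x where x: "x \<in> (if flip then bd_edges n b a else bd_edges n a b)"
    "ray_exits_through n (p \<circ> relabel flip c n) \<L> l k x" by blast
  moreover from this have "x < n" using assms by (auto simp: mem_bd_edges split: if_splits)
  ultimately show ?B
    using edge_relabel_bd_edges[OF assms] ray_exits_through_relabel by blast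
next
  assume ?B
  then obtain y where y: "y \<in> bd_edges n (relabel flip c n a) (relabel flip c n b)"
    "ray_exits_through n p \<L> (relabel flip c n l) (relabel flip c n k) y" by blast
  then have "y \<in> edge_relabel flip c n ` {..<n}"
    unfolding edge_relabel_surj using assms by (auto simp: mem_bd_edges relabel_less)
  then obtain x where "x < n" "y = edge_relabel flip c n x" by auto
  with y show ?A
    using edge_relabel_bd_edges[OF assms] ray_exits_through_relabel by blast
qed

text \<open>The two disjuncts in \<open>designated_blocker\<close> are mirror images; a flip
  exchanges them, so the disjunction as a whole is invariant.\<close>

lemma designated_blocker_relabel:
  assumes "a < n" "b < n" "k < n"
  shows "designated_blocker n (p \<circ> relabel flip c n) \<L> a b k \<longleftrightarrow>
    designated_blocker n p \<L> (relabel flip c n a) (relabel flip c n b) (relabel flip c n k)"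
proof -
  let ?v = "relabel flip c n"
  have bdv: "?v k \<in> bd_vertices n (?v a) (?v b) \<longleftrightarrow> k \<in> (if flip then bd_vertices n b a else bd_vertices n a b)"
    "?v k \<in> bd_vertices n (?v b) (?v a) \<longleftrightarrow> k \<in> (if flip then bd_vertices n a b else bd_vertices n b a)"
    using relabel_bd_vertices[OF assms] relabel_bd_vertices[OF assms(2,1,3)] by auto
  show ?thesis
    unfolding designated_blocker_def invisible_pair_def sees_relabel bdv
      bd_edges_ray_exits_relabel[OF assms(1,2), symmetric] bd_edges_ray_exits_relabel[OF assms(2,1), symmetric]
    using assms by (cases flip) (auto simp: relabel_eq_iff relabel_less)
qed

lemma edge_cycle_relabel: "edge_cycle n (p \<circ> relabel flip c n) \<L>"
proof
  let ?v = "relabel flip c n"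
  show "pseudo_configuration n (p \<circ> ?v) \<L>"
    unfolding pseudo_configuration_def
  proof (intro conjI)
    have "inj_on p {..<n}" using config by (simp add: pseudo_configuration_def)
    then show "inj_on (p \<circ> ?v) {..<n}"
      by (intro comp_inj_on relabel_inj) (simp add: relabel_surj)
    show "card \<L> = n choose 2" using config by (simp add: pseudo_configuration_def)
    show "\<forall>i<n. \<forall>j<n. i \<noteq> j \<longrightarrow> (\<exists>!L. L \<in> \<L> \<and> (p \<circ> ?v) i \<in> L \<and> (p \<circ> ?v) j \<in> L)"
      using line_ex1[OF relabel_less relabel_less] by (simp add: relabel_eq_iff)
    have "(p \<circ> ?v) ` {..<n} = p ` {..<n}" by (metis image_comp relabel_surj)
    then show "\<forall>L\<in>\<L>. card (L \<inter> (p \<circ> ?v) ` {..<n}) = 2"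
      using config by (simp add: pseudo_configuration_def)
  qed (simp_all add: n_ge_3 arrangement)
  let ?e = "edge_relabel flip c n"
  \<comment> \<open>Consecutive edges stay consecutive, in reversed order under a flip; their common
    vertex has the index of whichever edge comes second in the original labelling.\<close>
  have step: "?e ((i + 1) mod n) = (?e i + 1) mod n \<and> ?v ((i + 1) mod n) = ?e ((i + 1) mod n) \<or>
      ?e i = (?e ((i + 1) mod n) + 1) mod n \<and> ?v ((i + 1) mod n) = ?e i" if "i < n" for i
    using relabel_succ(1)[OF that] relabel_succ(2)[of "(i + 1) mod n" n c] that
    unfolding edge_relabel_def by (cases flip) auto
  show "edge n (p \<circ> ?v) \<L> i \<inter> edge n (p \<circ> ?v) \<L> ((i + 1) mod n) = {(p \<circ> ?v) ((i + 1) mod n)}"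
    if "i < n" for i
    using step[OF that] consecutive[OF edge_relabel_less, of i flip c]
      consecutive[OF edge_relabel_less, of "(i + 1) mod n" flip c] that succ_mod_props(1)[OF that]
    by (auto simp: edge_relabel)
  show "edge n (p \<circ> ?v) \<L> i \<inter> edge n (p \<circ> ?v) \<L> j = {}"
    if ij: "i < n" "j < n" "i \<noteq> j" "j \<noteq> (i + 1) mod n" "i \<noteq> (j + 1) mod n" for i j
  proof -
    have e: "?e a = ?e b \<longleftrightarrow> a = b" if "a < n" "b < n" for a b
      using inj_on_eq_iff[OF edge_relabel_inj] that by auto
    have "?e j \<noteq> (?e i + 1) mod n \<and> ?e i \<noteq> (?e j + 1) mod n"
    proof (cases flip)
      case True
      have "(?e i + 1) mod n = ?v i" "(?e j + 1) mod n = ?v j"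
        using relabel_succ(2)[OF ij(1), of c] relabel_succ(2)[OF ij(2), of c] True
        unfolding edge_relabel_def by auto
      then show ?thesis
        using ij relabel_eq_iff[of "(j + 1) mod n" i True c] relabel_eq_iff[of "(i + 1) mod n" j True c]
          succ_mod_props(1) True unfolding edge_relabel_def by auto
    next
      case False
      then show ?thesis
        using ij relabel_eq_iff[of j "(i + 1) mod n" False c] relabel_eq_iff[of i "(j + 1) mod n" False c]
          succ_mod_props(1) relabel_succ(1)[OF ij(1), of c] relabel_succ(1)[OF ij(2), of c]
        unfolding edge_relabel_def by auto
    qed
    then show ?thesis
      using disjoint[of "?e i" "?e j"] ij e by (simp add: edge_relabel edge_relabel_less)
  qed
qed

text \<open>Adds the degenerate case \<open>s = 0\<close>, where \<open>p s\<close> is the first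
  vertex of the given pair: the first claim is then the hypothesis \<open>db\<close>, and the
  premise of the second contradicts that this vertex sees its blocker.\<close>

lemma blocker_transfer_relabel:
  assumes lt: "j < n" "k < j" "s < k"
    and db: "designated_blocker n p \<L> (relabel flip c n 0) (relabel flip c n j) (relabel flip c n k)"
    and l: "l < n"
  shows "sees n p \<L> (relabel flip c n s) (relabel flip c n k) \<Longrightarrow>
      designated_blocker n p \<L> (relabel flip c n s) (relabel flip c n j) (relabel flip c n k)"
    and "designated_blocker n p \<L> (relabel flip c n s) (relabel flip c n k) l \<Longrightarrow>
      designated_blocker n p \<L> (relabel flip c n s) (relabel flip c n j) l"
proof -
  let ?v = "relabel flip c n"
  interpret q: edge_cycle n "p \<circ> ?v" \<L> by (rule edge_cycle_relabel)
  have db': "designated_blocker n (p \<circ> ?v) \<L> 0 j k"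
    using db lt by (simp add: designated_blocker_relabel)
  show "designated_blocker n p \<L> (?v s) (?v j) (?v k)" if "sees n p \<L> (?v s) (?v k)"
  proof (cases "s = 0")
    case False
    then have "designated_blocker n (p \<circ> ?v) \<L> s j k"
      using q.blocker_transfer(1)[OF db'] lt that by (simp add: sees_relabel)
    then show ?thesis using lt by (simp add: designated_blocker_relabel)
  qed (use db in simp)
  obtain l' where l': "l' < n" "l = ?v l'"
    using l relabel_surj[of flip c n] by (metis imageE lessThan_iff)
  show "designated_blocker n p \<L> (?v s) (?v j) l" if dbl: "designated_blocker n p \<L> (?v s) (?v k) l"
  proof (cases "s = 0")
    case True
    then show ?thesis
      using db dbl unfolding designated_blocker_def invisible_pair_def by simp
  next
    case False
    have "designated_blocker n (p \<circ> ?v) \<L> s k l'"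
      using dbl lt l' by (simp add: designated_blocker_relabel)
    then have "designated_blocker n (p \<circ> ?v) \<L> s j l'"
      using q.blocker_transfer(2)[OF db'] lt False by simp
    then show ?thesis using lt l' by (simp add: designated_blocker_relabel)
  qed
qed

end

section \<open>Reduction of the theorem to increasing indices starting at 0\<close>

theorem mainTheorem4:
  fixes n :: nat and p :: "nat \<Rightarrow> complex" and \<L> :: "complex set set" and i j k s :: nat
  assumes "pseudo_polygon n p \<L>"
    and "invisible_pair n p \<L> i j"
    and "designated_blocker n p \<L> i j k"
    and "k \<in> bd_vertices n i j \<and> s \<in> bd_vertices n i ((k + n - 1) mod n) \<or>
         k \<in> bd_vertices n j i \<and> s \<in> bd_vertices n ((k + 1) mod n) i"
  shows "(visible_pair n p \<L> s k \<and> designated_blocker n p \<L> s j k) \<noteq>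
         (invisible_pair n p \<L> s k \<and>
           (\<forall>t. designated_blocker n p \<L> s k t \<longrightarrow> designated_blocker n p \<L> s j t))"
proof -
  interpret edge_cycle n p \<L>
    using assms(1) unfolding pseudo_polygon_def by unfold_locales blast+
  have ijk: "i < n" "j < n" "k < n" "k \<noteq> i" "k \<noteq> j" "i \<noteq> j"
    using assms(3) unfolding designated_blocker_def invisible_pair_def by auto
  obtain flip where flip: "k \<in> (if flip then bd_vertices n j i else bd_vertices n i j)"
    "s \<in> (if flip then bd_vertices n ((k + 1) mod n) i else bd_vertices n i ((k + n - 1) mod n))"
    using assms(4) by (metis (full_types))
  \<comment> \<open>With shift \<open>i\<close> the label 0 stands for \<open>i\<close>, and
    \<open>flip\<close> is chosen so that \<open>k\<close> is met before \<open>j\<close> when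
    labels increase.\<close>
  define v where "v = relabel flip i n"
  have v_less: "a < n \<Longrightarrow> v a < n" for a unfolding v_def by (rule relabel_less)
  have v0: "v 0 = i" unfolding v_def relabel_def using ijk by simp
  have surj: "\<exists>b<n. a = v b" if "a < n" for a
    using that relabel_surj[of flip i n] unfolding v_def by (metis imageE lessThan_iff)
  obtain j' k' where jk: "j' < n" "j = v j'" "k' < n" "k = v k'"
    using surj ijk by metis
  have bd: "x \<in> (if flip then bd_vertices n (v b) (v a) else bd_vertices n (v a) (v b)) \<longleftrightarrow>
      (\<exists>y \<in> bd_vertices n a b. x = v y)" if "a < n" "b < n" for a b x
  proof -
    have "x < n" if "x \<in> (if flip then bd_vertices n (v b) (v a) else bd_vertices n (v a) (v b))"
      using that mem_bd_vertices[of "v a" n "v b" x] mem_bd_vertices[of "v b" n "v a" x]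
        v_less \<open>a < n\<close> \<open>b < n\<close> by (auto split: if_splits)
    moreover have "v y \<in> (if flip then bd_vertices n (v b) (v a) else bd_vertices n (v a) (v b))
        \<longleftrightarrow> y \<in> bd_vertices n a b" if "y < n" for y
      using relabel_bd_vertices[OF \<open>a < n\<close> \<open>b < n\<close> that, of flip i]
        relabel_bd_vertices[OF \<open>b < n\<close> \<open>a < n\<close> that, of flip i] unfolding v_def by (cases flip) auto
    moreover have "y < n" if "y \<in> bd_vertices n a b" for y
      using that mem_bd_vertices \<open>a < n\<close> \<open>b < n\<close> by auto
    ultimately show ?thesis using surj by metis
  qed
  have v_inj: "v a = v b \<longleftrightarrow> a = b" if "a < n" "b < n" for a b
    unfolding v_def using relabel_eq_iff that by auto
  have n: "0 < n" using ijk by simp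
  have "k' \<le> j'"
  proof -
    obtain y where "y \<in> bd_vertices n 0 j'" "v k' = v y"
      using flip(1) bd[OF n jk(1), of k] unfolding v0 jk(2,4) by auto
    then show ?thesis using v_inj jk by (auto simp: bd_vertices_le)
  qed
  moreover have "k' \<noteq> j'" using ijk(5) jk(2,4) by blast
  moreover have "k' \<noteq> 0" using ijk(4) jk(4) v0 by metis
  ultimately have k': "k' < j'" "0 < k'" by auto
  \<comment> \<open>In either orientation the neighbour of \<open>k\<close> towards \<open>i\<close>
    is the one with the preceding label; \<open>0 < k'\<close> makes the subtraction exact.\<close>
  have "int (if flip then (k + 1) mod n else (k + n - 1) mod n) = int (v (k' - 1))"
    using jk(3) k'(2) mod_add_self2[of "(int i + int k') mod int n - 1" "int n"] unfolding jk(4) v_def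
    by (simp add: int_relabel zmod_int of_nat_diff mod_simps algebra_simps)
  then have "(if flip then (k + 1) mod n else (k + n - 1) mod n) = v (k' - 1)" by linarith
  then have "s \<in> (if flip then bd_vertices n (v (k' - 1)) (v 0) else bd_vertices n (v 0) (v (k' - 1)))"
    using flip(2) v0 by (auto split: if_splits)
  then obtain s' where "s' \<in> bd_vertices n 0 (k' - 1)" and s: "s = v s'"
    using bd[of 0 "k' - 1" s] n jk(3) by auto
  then have s': "s' < k'" using k' jk(3) by (auto simp: bd_vertices_le)
  have db: "designated_blocker n p \<L> (relabel flip i n 0) (relabel flip i n j') (relabel flip i n k')"
    using assms(3) v0 jk unfolding v_def by simp
  have "sees n p \<L> s k \<Longrightarrow> designated_blocker n p \<L> s j k"
    using blocker_transfer_relabel(1)[OF jk(1) k'(1) s' db n] unfolding s jk(2,4) v_def .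
  moreover have "designated_blocker n p \<L> s j t" if "designated_blocker n p \<L> s k t" for t
  proof -
    have "t < n" using that unfolding designated_blocker_def by blast
    then show ?thesis
      using blocker_transfer_relabel(2)[OF jk(1) k'(1) s' db] that unfolding s jk(2,4) v_def by blast
  qed
  moreover have "s < n" "s \<noteq> k"
    using s s' jk v_less v_inj[of s' k'] by auto
  \<comment> \<open>The inequality of truth values is an exclusive or. Visibility of
    \<open>p k\<close> from \<open>p s\<close> decides which side holds, and the transfer supplies
    the rest of that side.\<close>
  ultimately show ?thesis
    unfolding visible_pair_def invisible_pair_def using ijk by blast
qed

end
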